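(* Let $R$ be a Frobenius-separable $k$-algebra with idempotent Frobenius system $(\phi,e)$, $e=e^{(1)}\otimes e^{(2)}\in R\otimes R$. Let $(H,\Gamma,C)$ be a $\times_R$-bialgebra, with $\Gamma(h)=h_{[1]}\otimes h_{[2]}$. Then the structure $(H,\Delta,\epsilon)$ of a weak bialgebra on the algebra $H$ is given by $$\Delta(h)=\overline{e^{(1)}}\,h_{[1]}\otimes e^{(2)}h_{[2]}\in H\otimes H,\qquad \epsilon(h)=\phi\bigl(C(h)(1)\bigr)\in k .$$
   Context: $k$ is a field; algebras (unital, associative), coalgebras, $\otimes$ are over $k$. Frobenius systems: A Frobenius system for a $k$-algebra $R$ is a pair $(\phi,e)$ of a linear map $\phi\colon R\to k$ and an element $e=e^{(1)}\otimes e^{(2)}\in R\otimes R$ (summation suppressed) with $r=\phi(re^{(1)})e^{(2)}=e^{(1)}\phi(e^{(2)}r)$ for all $r\in R$. It is an idempotent Frobenius system if moreover $e^{(1)}e^{(2)}=1$. $R$ is Frobenius-separable if an idempotent Frobenius system exists. Weak bialgebra: an algebra and coalgebra $H$ with $\Delta(gh)=\Delta(g)\Delta(h)$ and, for all $f,g,h\in H$: $\epsilon(fgh)=\epsilon(fg_{(1)})\epsilon(g_{(2)}h)=\epsilon(fg_{(2)})\epsilon(g_{(1)}h)$, and $1_{(1)}\otimes1_{(2)}\otimes1_{(3)}=(\Delta(1)\otimes1)(1\otimes\Delta(1))=(1\otimes\Delta(1))(\Delta(1)\otimes1)$, where $\Delta(h)=h_{(1)}\otimes h_{(2)}$. $\times_R$-bialgebras: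 Let $R$ be a $k$-algebra, $\overline R$ its opposite algebra, $r\mapsto\overline r$ the canonical anti-isomorphism $R\to\overline R$, $R^e=R\otimes\overline R$, $r\overline s:=r\otimes\overline s$. An $R^e$-ring is a $k$-algebra $L$ with an algebra map $R^e\to L$; one writes $r,\overline s$ also for images in $L$. For left $R^e$-modules $M,N$, $M\diamond N:=M\otimes N/\langle\overline rm\otimes n-m\otimes rn\mid r\in R,m\in M,n\in N\rangle$. For $R^e$-bimodules $M,N$, $M\times_RN\subset M\diamond N$ is the subspace of all $\sum m_i\otimes n_i$ with $\sum m_i\overline s\otimes n_i=\sum m_i\otimes n_is$ for all $s\in R$. If $M,N$ are $R^e$-rings, so is $M\times_RN$ with multiplication $(\sum m_i\otimes n_i)(\sum m_j'\otimes n_j')=\sum m_im_j'\otimes n_in_j'$ and $R^e$-ring structure $r\otimes\overline s\mapsto r\otimes\overline s$ (i.e. the image of $r$ in the first factor, that of $\overline s$ in the second). $\operatorname{End}(R)$ ($k$-linear endomorphisms) is an $R^e$-ring via $r\otimes\overline s\mapsto(t\mapsto rts)$. A $\times_R$-bialgebra is an $R^e$-ring $L$ with homomorphisms of $R^e$-rings (algebra maps over $R^e$) $\Gamma\colon L\to L\times_RL$, $\Gamma(\ell)=\ell_{[1]}\otimes\ell_{[2]}$, and $C\colon L\to\operatorname{End}(R)$ such that the induced map $\Gamma_0\colon L\to L\diamond L$ is coassociative, $(\Gamma_0\diamond L)\Gamma_0=(L\diamond\Gamma_0)\Gamma_0\colon L\to L\diamond L\diamond L$, and $\overline{C(\ell_{[2]})(1)}\,\ell_{[1]}=\ell=C(\ell_{[1]})(1)\,\ell_{[2]}$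 for all $\ell\in L$. *)

theory Defs
  imports Complex_Main "HOL-Library.Poly_Mapping"
begin

section \<open>Linearisation and quotients\<close>

text \<open>
  The type \<open>'a \<Rightarrow>\<^sub>0 'k\<close> serves as the vector space over \<open>'k\<close> with basis \<open>'a\<close>.
  Tensor products are quotients of it, for \<open>'a\<close> a type of pairs or triples.
  Their elements are cosets, hence have type \<open>('a \<Rightarrow>\<^sub>0 'k) set\<close>.
\<close>

definition fscale :: "'k \<Rightarrow> ('a \<Rightarrow>\<^sub>0 'k) \<Rightarrow> ('a \<Rightarrow>\<^sub>0 'k::field)" where
  "fscale c = Poly_Mapping.map (\<lambda>d. c * d)"

lemma lookup_fscale: "Poly_Mapping.lookup (fscale c x) a = c * Poly_Mapping.lookup x a"
  by (simp add: fscale_def Poly_Mapping.map.rep_eq when_def)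

global_interpretation free: vector_space fscale
  by unfold_locales
    (auto intro!: poly_mapping_eqI simp: lookup_fscale lookup_add algebra_simps)

abbreviation basis :: "'a \<Rightarrow> ('a \<Rightarrow>\<^sub>0 'k::field)" where
  "basis a \<equiv> Poly_Mapping.single a 1"

definition lin_ext ::
    "('k::field \<Rightarrow> 'v::ab_group_add \<Rightarrow> 'v) \<Rightarrow> ('a \<Rightarrow> 'v) \<Rightarrow> ('a \<Rightarrow>\<^sub>0 'k) \<Rightarrow> 'v" where
  "lin_ext scale f x = (\<Sum>a\<in>Poly_Mapping.keys x. scale (Poly_Mapping.lookup x a) (f a))"

definition free_map :: "('a \<Rightarrow> 'b) \<Rightarrow> ('a \<Rightarrow>\<^sub>0 'k::field) \<Rightarrow> ('b \<Rightarrow>\<^sub>0 'k)" where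
  "free_map f = lin_ext fscale (\<lambda>a. basis (f a))"

definition free_map2 ::
    "('a \<Rightarrow> 'b \<Rightarrow> 'c) \<Rightarrow> ('a \<Rightarrow>\<^sub>0 'k::field) \<Rightarrow> ('b \<Rightarrow>\<^sub>0 'k) \<Rightarrow> ('c \<Rightarrow>\<^sub>0 'k)" where
  "free_map2 f x y = lin_ext fscale (\<lambda>a. free_map (f a) y) x"

definition coset :: "('a \<Rightarrow>\<^sub>0 'k::field) set \<Rightarrow> ('a \<Rightarrow>\<^sub>0 'k) \<Rightarrow> ('a \<Rightarrow>\<^sub>0 'k) set" where
  "coset U x = {y. y - x \<in> U}"

definition quot :: "('a \<Rightarrow>\<^sub>0 'k::field) set \<Rightarrow> ('a \<Rightarrow>\<^sub>0 'k) set set" where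
  "quot U = range (coset U)"

lemma coset_eq_iff:
  assumes "free.subspace U"
  shows "coset U x = coset U y \<longleftrightarrow> x - y \<in> U"
proof
  assume "coset U x = coset U y"
  moreover have "x \<in> coset U x"
    using assms by (simp add: coset_def free.subspace_0)
  ultimately show "x - y \<in> U" by (simp add: coset_def)
next
  assume xy: "x - y \<in> U"
  have "z - y \<in> U" if "z - x \<in> U" for z
    using free.subspace_add[OF assms that xy] by simp
  moreover have "z - x \<in> U" if "z - y \<in> U" for z
    using free.subspace_diff[OF assms that xy] by simp
  ultimately show "coset U x = coset U y" by (auto simp: coset_def)
qed

text \<open>
  Maps out of quotients are given by a formula on representatives. The image of an element is the
  value common to all representatives, and it is unspecified if the formula depends on the
  representatives. \<open>qlift\<close> has values in a vector space with scalar multiplication \<open>scale\<close>,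
  \<open>qmap\<close> and \<open>qmap2\<close> have values in the quotient by \<open>V\<close>.
\<close>

definition qlift ::
    "('k::field \<Rightarrow> 'v::ab_group_add \<Rightarrow> 'v) \<Rightarrow> ('a \<Rightarrow> 'v) \<Rightarrow> ('a \<Rightarrow>\<^sub>0 'k) set \<Rightarrow> 'v" where
  "qlift scale f X = the_elem (lin_ext scale f ` X)"

definition qmap ::
    "('b \<Rightarrow>\<^sub>0 'k::field) set \<Rightarrow> (('a \<Rightarrow>\<^sub>0 'k) \<Rightarrow> ('b \<Rightarrow>\<^sub>0 'k)) \<Rightarrow> ('a \<Rightarrow>\<^sub>0 'k) set \<Rightarrow> ('b \<Rightarrow>\<^sub>0 'k) set"
  where "qmap V F X = the_elem ((\<lambda>x. coset V (F x)) ` X)"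

definition qmap2 ::
    "('c \<Rightarrow>\<^sub>0 'k::field) set \<Rightarrow> (('a \<Rightarrow>\<^sub>0 'k) \<Rightarrow> ('b \<Rightarrow>\<^sub>0 'k) \<Rightarrow> ('c \<Rightarrow>\<^sub>0 'k)) \<Rightarrow>
      ('a \<Rightarrow>\<^sub>0 'k) set \<Rightarrow> ('b \<Rightarrow>\<^sub>0 'k) set \<Rightarrow> ('c \<Rightarrow>\<^sub>0 'k) set"
  where "qmap2 V F X Y = the_elem ((\<lambda>(x, y). coset V (F x y)) ` (X \<times> Y))"

definition qadd :: "('a \<Rightarrow>\<^sub>0 'k::field) set \<Rightarrow> ('a \<Rightarrow>\<^sub>0 'k) set \<Rightarrow> ('a \<Rightarrow>\<^sub>0 'k) set \<Rightarrow> ('a \<Rightarrow>\<^sub>0 'k) set"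
  where "qadd U = qmap2 U (+)"

definition qscale :: "('a \<Rightarrow>\<^sub>0 'k::field) set \<Rightarrow> 'k \<Rightarrow> ('a \<Rightarrow>\<^sub>0 'k) set \<Rightarrow> ('a \<Rightarrow>\<^sub>0 'k) set"
  where "qscale U c = qmap U (fscale c)"

definition linear_into_quot ::
    "('k::field \<Rightarrow> 'v::ab_group_add \<Rightarrow> 'v) \<Rightarrow> ('a \<Rightarrow>\<^sub>0 'k) set \<Rightarrow> ('v \<Rightarrow> ('a \<Rightarrow>\<^sub>0 'k) set) \<Rightarrow> bool"
  where
  "linear_into_quot scale U f \<longleftrightarrow>
    (\<forall>v. f v \<in> quot U) \<and>
    (\<forall>v w. f (v + w) = qadd U (f v) (f w)) \<and>
    (\<forall>c v. f (scale c v) = qscale U c (f v))"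

section \<open>Algebras and tensor products\<close>

text \<open>The sort \<open>{ring, monoid_mult}\<close> is used rather than \<open>ring_1\<close> so that the zero algebra is allowed.\<close>

locale k_algebra = vector_space scale
  for scale :: "'k::field \<Rightarrow> 'a::{ring, monoid_mult} \<Rightarrow> 'a" +
  assumes scale_mult_left: "scale c x * y = scale c (x * y)"
    and scale_mult_right: "x * scale c y = scale c (x * y)"

definition bilinear_relators ::
    "('k::field \<Rightarrow> 'a::ab_group_add \<Rightarrow> 'a) \<Rightarrow> ('k \<Rightarrow> 'b::ab_group_add \<Rightarrow> 'b) \<Rightarrow> ('a \<times> 'b \<Rightarrow>\<^sub>0 'k) set"
  where
  "bilinear_relators sA sB =
     {basis (a + a', b) - basis (a, b) - basis (a', b) | a a' b. True} \<union>
     {basis (a, b + b') - basis (a, b) - basis (a, b') | a b b'. True} \<union>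
     {basis (sA c a, b) - fscale c (basis (a, b)) | c a b. True} \<union>
     {basis (a, sB c b) - fscale c (basis (a, b)) | c a b. True}"

definition trilinear_relators ::
    "('k::field \<Rightarrow> 'a::ab_group_add \<Rightarrow> 'a) \<Rightarrow> ('a \<times> 'a \<times> 'a \<Rightarrow>\<^sub>0 'k) set" where
  "trilinear_relators sA =
     {basis (a + a', b, c) - basis (a, b, c) - basis (a', b, c) | a a' b c. True} \<union>
     {basis (a, b + b', c) - basis (a, b, c) - basis (a, b', c) | a b b' c. True} \<union>
     {basis (a, b, c + c') - basis (a, b, c) - basis (a, b, c') | a b c c'. True} \<union>
     {basis (sA d a, b, c) - fscale d (basis (a, b, c)) | a b c d. True} \<union>
     {basis (a, sA d b, c) - fscale d (basis (a, b, c)) | a b c d. True} \<union>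
     {basis (a, b, sA d c) - fscale d (basis (a, b, c)) | a b c d. True}"

text \<open>
  \<open>A \<otimes> A\<close> is \<open>quot (tensor2 sA)\<close> and \<open>A \<otimes> A \<otimes> A\<close> is \<open>quot (tensor3 sA)\<close>.
\<close>

definition tensor2 :: "('k::field \<Rightarrow> 'a::ab_group_add \<Rightarrow> 'a) \<Rightarrow> ('a \<times> 'a \<Rightarrow>\<^sub>0 'k) set" where
  "tensor2 sA = free.span (bilinear_relators sA sA)"

definition tensor3 :: "('k::field \<Rightarrow> 'a::ab_group_add \<Rightarrow> 'a) \<Rightarrow> ('a \<times> 'a \<times> 'a \<Rightarrow>\<^sub>0 'k) set" where
  "tensor3 sA = free.span (trilinear_relators sA)"

definition mult2 :: "('a::times \<times> 'a \<Rightarrow>\<^sub>0 'k::field) \<Rightarrow> ('a \<times> 'a \<Rightarrow>\<^sub>0 'k) \<Rightarrow> ('a \<times> 'a \<Rightarrow>\<^sub>0 'k)" where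
  "mult2 = free_map2 (\<lambda>(a, b) (a', b'). (a * a', b * b'))"

definition mult3 ::
    "('a::times \<times> 'a \<times> 'a \<Rightarrow>\<^sub>0 'k::field) \<Rightarrow> ('a \<times> 'a \<times> 'a \<Rightarrow>\<^sub>0 'k) \<Rightarrow> ('a \<times> 'a \<times> 'a \<Rightarrow>\<^sub>0 'k)" where
  "mult3 = free_map2 (\<lambda>(a, b, c) (a', b', c'). (a * a', b * b', c * c'))"

text \<open>
  For \<open>f\<close> with values \<open>f a\<close> in a quotient of \<open>A \<otimes> A\<close>, these are the maps \<open>f \<otimes> id\<close> and \<open>id \<otimes> f\<close>
  with values in the quotient by \<open>V\<close>. A choice \<open>g\<close> of a representative for each \<open>f a\<close> is part of the
  data on which the formula must not depend.
\<close>

definition map_left ::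
    "('a \<times> 'a \<times> 'a \<Rightarrow>\<^sub>0 'k::field) set \<Rightarrow> ('a \<Rightarrow> ('a \<times> 'a \<Rightarrow>\<^sub>0 'k) set) \<Rightarrow>
      ('a \<times> 'a \<Rightarrow>\<^sub>0 'k) set \<Rightarrow> ('a \<times> 'a \<times> 'a \<Rightarrow>\<^sub>0 'k) set" where
  "map_left V f X = the_elem
     {coset V (lin_ext fscale (\<lambda>(a, b). free_map (\<lambda>(p, q). (p, q, b)) (g a)) x)
      | x g. x \<in> X \<and> (\<forall>a. g a \<in> f a)}"

definition map_right ::
    "('a \<times> 'a \<times> 'a \<Rightarrow>\<^sub>0 'k::field) set \<Rightarrow> ('a \<Rightarrow> ('a \<times> 'a \<Rightarrow>\<^sub>0 'k) set) \<Rightarrow>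
      ('a \<times> 'a \<Rightarrow>\<^sub>0 'k) set \<Rightarrow> ('a \<times> 'a \<times> 'a \<Rightarrow>\<^sub>0 'k) set" where
  "map_right V f X = the_elem
     {coset V (lin_ext fscale (\<lambda>(a, b). free_map (\<lambda>(p, q). (a, p, q)) (g b)) x)
      | x g. x \<in> X \<and> (\<forall>a. g a \<in> f a)}"

section \<open>Frobenius systems\<close>

definition frobenius_system ::
    "('k::field \<Rightarrow> 'r::{ring, monoid_mult} \<Rightarrow> 'r) \<Rightarrow> ('r \<Rightarrow> 'k) \<Rightarrow> ('r \<times> 'r \<Rightarrow>\<^sub>0 'k) set \<Rightarrow> bool" where
  "frobenius_system sR \<phi> e \<longleftrightarrow>
     Vector_Spaces.linear sR (*) \<phi> \<and> e \<in> quot (tensor2 sR) \<and>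
     (\<forall>r. r = qlift sR (\<lambda>(a, b). sR (\<phi> (r * a)) b) e) \<and>
     (\<forall>r. r = qlift sR (\<lambda>(a, b). sR (\<phi> (b * r)) a) e)"

definition idempotent_frobenius_system ::
    "('k::field \<Rightarrow> 'r::{ring, monoid_mult} \<Rightarrow> 'r) \<Rightarrow> ('r \<Rightarrow> 'k) \<Rightarrow> ('r \<times> 'r \<Rightarrow>\<^sub>0 'k) set \<Rightarrow> bool" where
  "idempotent_frobenius_system sR \<phi> e \<longleftrightarrow>
     frobenius_system sR \<phi> e \<and> qlift sR (\<lambda>(a, b). a * b) e = 1"

section \<open>Weak bialgebras\<close>

definition coalgebra ::
    "('k::field \<Rightarrow> 'h::ab_group_add \<Rightarrow> 'h) \<Rightarrow> ('h \<Rightarrow> ('h \<times> 'h \<Rightarrow>\<^sub>0 'k) set) \<Rightarrow> ('h \<Rightarrow> 'k) \<Rightarrow> bool" where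
  "coalgebra sH \<Delta> \<epsilon> \<longleftrightarrow>
     linear_into_quot sH (tensor2 sH) \<Delta> \<and> Vector_Spaces.linear sH (*) \<epsilon> \<and>
     (\<forall>h. map_left (tensor3 sH) \<Delta> (\<Delta> h) = map_right (tensor3 sH) \<Delta> (\<Delta> h)) \<and>
     (\<forall>h. qlift sH (\<lambda>(a, b). sH (\<epsilon> a) b) (\<Delta> h) = h) \<and>
     (\<forall>h. qlift sH (\<lambda>(a, b). sH (\<epsilon> b) a) (\<Delta> h) = h)"

definition weak_bialgebra ::
    "('k::field \<Rightarrow> 'h::{ring, monoid_mult} \<Rightarrow> 'h) \<Rightarrow> ('h \<Rightarrow> ('h \<times> 'h \<Rightarrow>\<^sub>0 'k) set) \<Rightarrow> ('h \<Rightarrow> 'k) \<Rightarrow> bool"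
  where
  "weak_bialgebra sH \<Delta> \<epsilon> \<longleftrightarrow>
     k_algebra sH \<and> coalgebra sH \<Delta> \<epsilon> \<and>
     (\<forall>g h. \<Delta> (g * h) = qmap2 (tensor2 sH) mult2 (\<Delta> g) (\<Delta> h)) \<and>
     (\<forall>f g h. \<epsilon> (f * g * h) = qlift (*) (\<lambda>(a, b). \<epsilon> (f * a) * \<epsilon> (b * h)) (\<Delta> g)) \<and>
     (\<forall>f g h. \<epsilon> (f * g * h) = qlift (*) (\<lambda>(a, b). \<epsilon> (f * b) * \<epsilon> (a * h)) (\<Delta> g)) \<and>
     (let one3 = map_left (tensor3 sH) \<Delta> (\<Delta> 1);
          \<Delta>1_1 = qmap (tensor3 sH) (free_map (\<lambda>(a, b). (a, b, 1))) (\<Delta> 1);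
          one_\<Delta>1 = qmap (tensor3 sH) (free_map (\<lambda>(a, b). (1, a, b))) (\<Delta> 1)
      in one3 = qmap2 (tensor3 sH) mult3 \<Delta>1_1 one_\<Delta>1 \<and>
         one3 = qmap2 (tensor3 sH) mult3 one_\<Delta>1 \<Delta>1_1)"

section \<open>Bialgebras over a noncommutative base\<close>

text \<open>
  The opposite algebra of \<open>R\<close> lives on the same type, so \<open>R\<^sup>e\<close> is the space \<open>quot (tensor2 sR)\<close>,
  where the coset of \<open>basis (r, s)\<close> stands for \<open>r \<otimes> s\<close> with \<open>s\<close> read in the opposite algebra.
\<close>

definition Re_mult ::
    "('r::times \<times> 'r \<Rightarrow>\<^sub>0 'k::field) \<Rightarrow> ('r \<times> 'r \<Rightarrow>\<^sub>0 'k) \<Rightarrow> ('r \<times> 'r \<Rightarrow>\<^sub>0 'k)" where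
  "Re_mult = free_map2 (\<lambda>(r, s) (r', s'). (r * r', s' * s))"

definition Re_ring ::
    "('k::field \<Rightarrow> 'r::{ring, monoid_mult} \<Rightarrow> 'r) \<Rightarrow> ('k \<Rightarrow> 'l::{ring, monoid_mult} \<Rightarrow> 'l) \<Rightarrow>
      (('r \<times> 'r \<Rightarrow>\<^sub>0 'k) set \<Rightarrow> 'l) \<Rightarrow> bool" where
  "Re_ring sR sL \<iota> \<longleftrightarrow>
     k_algebra sR \<and> k_algebra sL \<and>
     (\<forall>X\<in>quot (tensor2 sR). \<forall>Y\<in>quot (tensor2 sR). \<iota> (qadd (tensor2 sR) X Y) = \<iota> X + \<iota> Y) \<and>
     (\<forall>c. \<forall>X\<in>quot (tensor2 sR). \<iota> (qscale (tensor2 sR) c X) = sL c (\<iota> X)) \<and>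
     (\<forall>X\<in>quot (tensor2 sR). \<forall>Y\<in>quot (tensor2 sR).
        \<iota> (qmap2 (tensor2 sR) Re_mult X Y) = \<iota> X * \<iota> Y) \<and>
     \<iota> (coset (tensor2 sR) (basis (1, 1))) = 1"

text \<open>The images in \<open>L\<close> of \<open>r\<close> in \<open>R\<close> and of the corresponding element of the opposite algebra.\<close>

definition inR ::
    "('k::field \<Rightarrow> 'r::{ring, monoid_mult} \<Rightarrow> 'r) \<Rightarrow> (('r \<times> 'r \<Rightarrow>\<^sub>0 'k) set \<Rightarrow> 'l) \<Rightarrow> 'r \<Rightarrow> 'l" where
  "inR sR \<iota> r = \<iota> (coset (tensor2 sR) (basis (r, 1)))"

definition inRbar ::
    "('k::field \<Rightarrow> 'r::{ring, monoid_mult} \<Rightarrow> 'r) \<Rightarrow> (('r \<times> 'r \<Rightarrow>\<^sub>0 'k) set \<Rightarrow> 'l) \<Rightarrow> 'r \<Rightarrow> 'l" where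
  "inRbar sR \<iota> r = \<iota> (coset (tensor2 sR) (basis (1, r)))"

text \<open>
  \<open>L \<diamond> L\<close> is \<open>quot (diamond2 sR sL \<iota>)\<close> and \<open>L \<diamond> L \<diamond> L\<close> is \<open>quot (diamond3 sR sL \<iota>)\<close>.
  The multiplication of \<open>L \<times>\<^sub>R L\<close> is \<open>mult2\<close> on representatives. It is well defined on the subspace
  \<open>timesR\<close>, not on all of \<open>L \<diamond> L\<close>.
\<close>

definition diamond2 ::
    "('k::field \<Rightarrow> 'r::{ring, monoid_mult} \<Rightarrow> 'r) \<Rightarrow> ('k \<Rightarrow> 'l::{ring, monoid_mult} \<Rightarrow> 'l) \<Rightarrow>
      (('r \<times> 'r \<Rightarrow>\<^sub>0 'k) set \<Rightarrow> 'l) \<Rightarrow> ('l \<times> 'l \<Rightarrow>\<^sub>0 'k) set" where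
  "diamond2 sR sL \<iota> = free.span (bilinear_relators sL sL \<union>
     {basis (inRbar sR \<iota> r * m, n) - basis (m, inR sR \<iota> r * n) | r m n. True})"

definition diamond3 ::
    "('k::field \<Rightarrow> 'r::{ring, monoid_mult} \<Rightarrow> 'r) \<Rightarrow> ('k \<Rightarrow> 'l::{ring, monoid_mult} \<Rightarrow> 'l) \<Rightarrow>
      (('r \<times> 'r \<Rightarrow>\<^sub>0 'k) set \<Rightarrow> 'l) \<Rightarrow> ('l \<times> 'l \<times> 'l \<Rightarrow>\<^sub>0 'k) set" where
  "diamond3 sR sL \<iota> = free.span (trilinear_relators sL \<union>
     {basis (inRbar sR \<iota> r * m, n, p) - basis (m, inR sR \<iota> r * n, p) | r m n p. True} \<union>
     {basis (m, inRbar sR \<iota> r * n, p) - basis (m, n, inR sR \<iota> r * p) | r m n p. True})"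

definition timesR ::
    "('k::field \<Rightarrow> 'r::{ring, monoid_mult} \<Rightarrow> 'r) \<Rightarrow> ('k \<Rightarrow> 'l::{ring, monoid_mult} \<Rightarrow> 'l) \<Rightarrow>
      (('r \<times> 'r \<Rightarrow>\<^sub>0 'k) set \<Rightarrow> 'l) \<Rightarrow> ('l \<times> 'l \<Rightarrow>\<^sub>0 'k) set set" where
  "timesR sR sL \<iota> = {X \<in> quot (diamond2 sR sL \<iota>). \<forall>s.
     qmap (diamond2 sR sL \<iota>) (free_map (\<lambda>(m, n). (m * inRbar sR \<iota> s, n))) X =
     qmap (diamond2 sR sL \<iota>) (free_map (\<lambda>(m, n). (m, n * inR sR \<iota> s))) X}"

definition Re_ring_hom_timesR ::
    "('k::field \<Rightarrow> 'r::{ring, monoid_mult} \<Rightarrow> 'r) \<Rightarrow> ('k \<Rightarrow> 'l::{ring, monoid_mult} \<Rightarrow> 'l) \<Rightarrow>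
      (('r \<times> 'r \<Rightarrow>\<^sub>0 'k) set \<Rightarrow> 'l) \<Rightarrow> ('l \<Rightarrow> ('l \<times> 'l \<Rightarrow>\<^sub>0 'k) set) \<Rightarrow> bool" where
  "Re_ring_hom_timesR sR sL \<iota> \<Gamma> \<longleftrightarrow>
     (\<forall>l. \<Gamma> l \<in> timesR sR sL \<iota>) \<and>
     linear_into_quot sL (diamond2 sR sL \<iota>) \<Gamma> \<and>
     (\<forall>l m. \<Gamma> (l * m) = qmap2 (diamond2 sR sL \<iota>) mult2 (\<Gamma> l) (\<Gamma> m)) \<and>
     \<Gamma> 1 = coset (diamond2 sR sL \<iota>) (basis (1, 1)) \<and>
     (\<forall>X\<in>quot (tensor2 sR). \<Gamma> (\<iota> X) =
        qmap (diamond2 sR sL \<iota>) (free_map (\<lambda>(r, s). (inR sR \<iota> r, inRbar sR \<iota> s))) X)"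

definition Re_ring_hom_End ::
    "('k::field \<Rightarrow> 'r::{ring, monoid_mult} \<Rightarrow> 'r) \<Rightarrow> ('k \<Rightarrow> 'l::{ring, monoid_mult} \<Rightarrow> 'l) \<Rightarrow>
      (('r \<times> 'r \<Rightarrow>\<^sub>0 'k) set \<Rightarrow> 'l) \<Rightarrow> ('l \<Rightarrow> 'r \<Rightarrow> 'r) \<Rightarrow> bool" where
  "Re_ring_hom_End sR sL \<iota> C \<longleftrightarrow>
     (\<forall>l. Vector_Spaces.linear sR sR (C l)) \<and>
     (\<forall>l m. C (l + m) = (\<lambda>t. C l t + C m t)) \<and>
     (\<forall>c l. C (sL c l) = (\<lambda>t. sR c (C l t))) \<and>
     (\<forall>l m. C (l * m) = C l \<circ> C m) \<and>
     C 1 = id \<and>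
     (\<forall>X\<in>quot (tensor2 sR). C (\<iota> X) = (\<lambda>t. qlift sR (\<lambda>(r, s). r * t * s) X))"

definition timesR_bialgebra ::
    "('k::field \<Rightarrow> 'r::{ring, monoid_mult} \<Rightarrow> 'r) \<Rightarrow> ('k \<Rightarrow> 'l::{ring, monoid_mult} \<Rightarrow> 'l) \<Rightarrow>
      (('r \<times> 'r \<Rightarrow>\<^sub>0 'k) set \<Rightarrow> 'l) \<Rightarrow> ('l \<Rightarrow> ('l \<times> 'l \<Rightarrow>\<^sub>0 'k) set) \<Rightarrow> ('l \<Rightarrow> 'r \<Rightarrow> 'r) \<Rightarrow> bool" where
  "timesR_bialgebra sR sL \<iota> \<Gamma> C \<longleftrightarrow>
     Re_ring sR sL \<iota> \<and> Re_ring_hom_timesR sR sL \<iota> \<Gamma> \<and> Re_ring_hom_End sR sL \<iota> C \<and>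
     (\<forall>l. map_left (diamond3 sR sL \<iota>) \<Gamma> (\<Gamma> l) = map_right (diamond3 sR sL \<iota>) \<Gamma> (\<Gamma> l)) \<and>
     (\<forall>l. qlift sL (\<lambda>(a, b). inRbar sR \<iota> (C b 1) * a) (\<Gamma> l) = l) \<and>
     (\<forall>l. qlift sL (\<lambda>(a, b). inR sR \<iota> (C a 1) * b) (\<Gamma> l) = l)"

end

theory Submission
  imports Defs
begin

text \<open>
  Since \<open>\<phi>(re\<^sub>1)e\<^sub>2 = r = e\<^sub>1\<phi>(e\<^sub>2r)\<close>, the element \<open>e\<close> satisfies the Casimir identity
  \<open>re\<^sub>1 \<otimes> e\<^sub>2 = e\<^sub>1 \<otimes> e\<^sub>2r\<close>. Hence applying \<open>e\<close> from the left gives a linear map from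
  \<open>H \<diamond> H\<close> to \<open>H \<otimes> H\<close>, and similarly with three factors, which carries coassociativity of \<open>\<Gamma>\<close> over to
  \<open>\<Delta>\<close>. Multiplicativity of \<open>\<Delta>\<close> also uses that \<open>\<Gamma>\<close> takes values in \<open>H \<times>\<^sub>R H\<close> and that
  \<open>e\<^sub>1e\<^sub>2 = 1\<close>. The axioms for \<open>\<epsilon>\<close> hold because \<open>\<phi>\<close> and \<open>e\<close> cancel, leaving identities for \<open>C\<close>.
\<close>

section \<open>Linear extension\<close>

text \<open>Maps on quotients are specified as the common value over all representatives, so every
  computation with them carries a well-definedness obligation, and the product on
  \<open>H \<diamond> H\<close> is only defined on a subspace. The proof therefore works on the dual
  side. It fixes representatives \<open>e0\<close> of \<open>e\<close> and \<open>\<gamma> h\<close>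
  of \<open>\<Gamma> h\<close>. The choice \<open>\<gamma>\<close> need be neither linear nor
  multiplicative, but its pairings with functionals that kill the relators behave as if it were.
  Such functionals are bilinear forms for \<open>H \<otimes> H\<close> and forms balanced over
  \<open>R\<close> for \<open>H \<diamond> H\<close>. Identities in Sweedler notation thus become
  identities between iterated finite sums \<open>lin_ext\<close>, whose order may be exchanged, and
  letting \<open>e\<close> act on a tensor becomes its transpose \<open>W\<close>, from bilinear to
  balanced forms. The counit computations rest on one fact: with \<open>i\<close> and
  \<open>j\<close> the maps of \<open>R\<close> and its opposite into \<open>H\<close>,
  \<open>C (i q)\<close> is left and \<open>C (j r)\<close> right multiplication. Hence, with
  \<open>(r, q)\<close> the legs of \<open>e\<close>, every expression has a factor
  \<open>\<phi> (x * r)\<close> or \<open>\<phi> (q * y)\<close>, which a Frobenius identity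
  contracts against the other leg.\<close>

lemma vector_space_mult: "vector_space ((*) :: 'k::field \<Rightarrow> 'k \<Rightarrow> 'k)"
  by unfold_locales (auto simp: algebra_simps)

lemma lin_ext_superset:
  assumes "vector_space s" "finite A" "Poly_Mapping.keys x \<subseteq> A"
  shows "lin_ext s f x = (\<Sum>a\<in>A. s (Poly_Mapping.lookup x a) (f a))"
proof -
  interpret vector_space s by fact
  show ?thesis
    unfolding lin_ext_def using assms(2,3)
    by (intro sum.mono_neutral_left) (auto simp: in_keys_iff)
qed

lemma linear_lin_ext:
  assumes "vector_space s"
  shows "Vector_Spaces.linear fscale s (lin_ext s f)"
proof -
  interpret vector_space s by fact
  have "lin_ext s f (x + y) = lin_ext s f x + lin_ext s f y" for x y
  proof -
    let ?A = "Poly_Mapping.keys x \<union> Poly_Mapping.keys y"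
    have "lin_ext s f (x + y) = (\<Sum>a\<in>?A. s (Poly_Mapping.lookup (x + y) a) (f a))"
      by (rule lin_ext_superset[OF assms]) (use Poly_Mapping.keys_add[of x y] in auto)
    moreover have "lin_ext s f x = (\<Sum>a\<in>?A. s (Poly_Mapping.lookup x a) (f a))"
      by (rule lin_ext_superset[OF assms]) auto
    moreover have "lin_ext s f y = (\<Sum>a\<in>?A. s (Poly_Mapping.lookup y a) (f a))"
      by (rule lin_ext_superset[OF assms]) auto
    ultimately show ?thesis
      by (simp add: lookup_add scale_left_distrib sum.distrib)
  qed
  moreover have "lin_ext s f (fscale c x) = s c (lin_ext s f x)" for c x
  proof -
    have "lin_ext s f (fscale c x)
        = (\<Sum>a\<in>Poly_Mapping.keys x. s (Poly_Mapping.lookup (fscale c x) a) (f a))"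
      by (rule lin_ext_superset[OF assms]) (auto simp: in_keys_iff lookup_fscale)
    then show ?thesis
      by (simp add: lin_ext_def lookup_fscale scale_sum_right)
  qed
  ultimately show ?thesis
    by (simp add: Vector_Spaces.linear_iff assms free.vector_space_axioms)
qed

lemma lin_ext_add: "vector_space s \<Longrightarrow> lin_ext s f (x + y) = lin_ext s f x + lin_ext s f y"
  and lin_ext_diff: "vector_space s \<Longrightarrow> lin_ext s f (x - y) = lin_ext s f x - lin_ext s f y"
  and lin_ext_fscale: "vector_space s \<Longrightarrow> lin_ext s f (fscale c x) = s c (lin_ext s f x)"
  using linear_lin_ext[of s f] unfolding module_hom_iff_linear[symmetric]
  by (simp_all add: module_hom.add module_hom.diff module_hom.scale)

lemma lin_ext_basis:
  assumes "vector_space s"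
  shows "lin_ext s f (basis a) = f a"
proof -
  interpret vector_space s by fact
  show ?thesis by (simp add: lin_ext_def)
qed

lemma linear_lin_ext_apply:
  assumes "Vector_Spaces.linear s s' F"
  shows "F (lin_ext s f x) = lin_ext s' (\<lambda>a. F (f a)) x"
proof -
  interpret Vector_Spaces.linear s s' F by fact
  show ?thesis by (simp add: lin_ext_def sum scale)
qed

lemma lin_ext_lin_ext:
  assumes "vector_space s"
  shows "lin_ext s f (lin_ext fscale g x) = lin_ext s (\<lambda>a. lin_ext s f (g a)) x"
  by (rule linear_lin_ext_apply) (rule linear_lin_ext[OF assms])

lemma lin_ext_free_map:
  assumes "vector_space s"
  shows "lin_ext s f (free_map g x) = lin_ext s (\<lambda>a. f (g a)) x"
  by (simp add: free_map_def lin_ext_lin_ext[OF assms] lin_ext_basis[OF assms])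

lemma lin_ext_free_map2:
  assumes "vector_space s"
  shows "lin_ext s f (free_map2 g x y) = lin_ext s (\<lambda>a. lin_ext s (\<lambda>b. f (g a b)) y) x"
  by (simp add: free_map2_def lin_ext_lin_ext[OF assms] lin_ext_free_map[OF assms])

lemma lin_ext_swap:
  assumes "vector_space s"
  shows "lin_ext s (\<lambda>a. lin_ext s (\<lambda>b. f a b) y) x = lin_ext s (\<lambda>b. lin_ext s (\<lambda>a. f a b) x) y"
proof -
  interpret vector_space s by fact
  show ?thesis
    unfolding lin_ext_def scale_sum_right by (subst sum.swap) (simp add: mult.commute)
qed

text \<open>Sweedler sums are pairings with functions on pairs; this form lets two of them be
  interchanged without unfolding the case expressions.\<close>

lemma lin_ext_swap_pairs:
  assumes "vector_space s"
  shows "lin_ext s (\<lambda>(a, b). lin_ext s (\<lambda>(c, d). f a b c d) y) x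
    = lin_ext s (\<lambda>(c, d). lin_ext s (\<lambda>(a, b). f a b c d) x) y"
  unfolding case_prod_unfold by (rule lin_ext_swap[OF assms])

text \<open>Needed because linear functionals obtained by extending from a basis are abstract maps,
  while all later tests have the form \<open>lin_ext\<close>.\<close>

lemma linear_eq_lin_ext:
  assumes "Vector_Spaces.linear fscale s F"
  shows "F x = lin_ext s (\<lambda>a. F (basis a)) x"
proof -
  have "x = lin_ext fscale basis x"
  proof (rule poly_mapping_eqI)
    fix a
    have "Poly_Mapping.lookup (lin_ext fscale basis x) a
        = (\<Sum>b\<in>Poly_Mapping.keys x. if b = a then Poly_Mapping.lookup x a else 0)"
      unfolding lin_ext_def lookup_sum
      by (rule sum.cong) (auto simp: lookup_fscale lookup_single)
    then show "Poly_Mapping.lookup x a = Poly_Mapping.lookup (lin_ext fscale basis x) a"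
      by (simp add: in_keys_iff)
  qed
  then show ?thesis using linear_lin_ext_apply[OF assms] by metis
qed

section \<open>Computing in quotients\<close>

text \<open>For a subspace \<open>U\<close>, this is the condition for \<open>f\<close> to induce a
  linear map out of the quotient by \<open>U\<close>; the scalar-valued such \<open>f\<close> form
  the dual of that quotient.\<close>

definition vanishes_on ::
    "('k::field \<Rightarrow> 'v::ab_group_add \<Rightarrow> 'v) \<Rightarrow> ('a \<Rightarrow>\<^sub>0 'k) set \<Rightarrow> ('a \<Rightarrow> 'v) \<Rightarrow> bool" where
  "vanishes_on s U f \<longleftrightarrow> (\<forall>u\<in>U. lin_ext s f u = 0)"

lemma vanishes_on_span:
  assumes "vector_space s"
  shows "vanishes_on s (free.span B) f \<longleftrightarrow> vanishes_on s B f"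
proof -
  interpret Vector_Spaces.linear fscale s "lin_ext s f" by (rule linear_lin_ext[OF assms])
  show ?thesis
    unfolding vanishes_on_def by (auto intro: eq_0_on_span free.span_base)
qed

text \<open>
  A subspace is the common kernel of the linear functionals that vanish on it, so identities between
  cosets reduce to identities in the field.
\<close>

lemma coset_eqI:
  fixes V :: "('a \<Rightarrow>\<^sub>0 'k::field) set"
  assumes V: "free.subspace V"
    and eq: "\<And>t. vanishes_on (*) V t \<Longrightarrow> lin_ext (*) t x = lin_ext (*) t y"
  shows "coset V x = coset V y"
proof (rule ccontr)
  assume "coset V x \<noteq> coset V y"
  then have ndiff: "x - y \<notin> V" by (simp add: coset_eq_iff[OF V])
  obtain B where B: "B \<subseteq> V" "free.independent B" "V \<subseteq> free.span B"
    by (rule free.basis_exists[of V]) blast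
  interpret P: vector_space_pair fscale "(*) :: 'k \<Rightarrow> 'k \<Rightarrow> 'k"
    by (intro vector_space_pair.intro free.vector_space_axioms vector_space_mult)
  have span: "free.span B \<subseteq> V" using B(1) V by (rule free.span_minimal)
  then have "free.independent (insert (x - y) B)"
    using B(2) ndiff by (intro free.independent_insertI) auto
  from P.linear_independent_extend[OF this, of "\<lambda>b. if b = x - y then 1 else 0"]
  obtain T where T: "Vector_Spaces.linear fscale (*) T"
    and Tb: "\<forall>b\<in>insert (x - y) B. T b = (if b = x - y then 1 else 0)" by blast
  interpret T: Vector_Spaces.linear fscale "(*)" T by (rule T)
  let ?t = "\<lambda>a. T (basis a)"
  have L: "lin_ext (*) ?t z = T z" for z
    by (rule linear_eq_lin_ext[OF T, symmetric])
  have "T b = 0" if "b \<in> B" for b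
    using Tb that ndiff B(1) by auto
  then have "T v = 0" if "v \<in> V" for v
    using T.eq_0_on_span[of B v] B(3) that by blast
  then have "vanishes_on (*) V ?t" by (simp add: vanishes_on_def L)
  then have "T x = T y" using eq[of ?t] by (simp add: L)
  moreover have "T (x - y) = 1" using Tb by simp
  ultimately show False by (simp add: T.diff)
qed

lemma coset_eqD:
  assumes "free.subspace V" "vector_space s" "vanishes_on s V f" "coset V x = coset V y"
  shows "lin_ext s f x = lin_ext s f y"
proof -
  interpret Vector_Spaces.linear fscale s "lin_ext s f" by (rule linear_lin_ext[OF assms(2)])
  have "lin_ext s f (x - y) = 0"
    using assms by (simp add: coset_eq_iff vanishes_on_def)
  then show ?thesis by (simp add: diff)
qed

lemma coset_self: "free.subspace U \<Longrightarrow> x \<in> coset U x"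
  by (simp add: coset_def free.subspace_0)

lemma mem_coset_iff: "free.subspace U \<Longrightarrow> y \<in> coset U x \<longleftrightarrow> coset U y = coset U x"
  by (simp add: coset_eq_iff) (simp add: coset_def)

lemma the_elem_eq:
  assumes "z \<in> Z" "\<And>w. w \<in> Z \<Longrightarrow> w = z"
  shows "the_elem Z = z"
proof -
  have "Z = {z}" using assms by blast
  then show ?thesis by simp
qed

lemma qlift_coset:
  assumes "free.subspace U" "vector_space s" "vanishes_on s U f"
  shows "qlift s f (coset U x) = lin_ext s f x"
  unfolding qlift_def
proof (rule the_elem_eq)
  show "lin_ext s f x \<in> lin_ext s f ` coset U x"
    by (rule imageI) (rule coset_self[OF assms(1)])
  fix w
  assume "w \<in> lin_ext s f ` coset U x"
  then obtain y where "coset U y = coset U x" "w = lin_ext s f y"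
    by (auto simp only: mem_coset_iff[OF assms(1)])
  then show "w = lin_ext s f x" using coset_eqD[OF assms] by metis
qed

lemma qmap_coset:
  assumes "free.subspace U" "\<And>y. coset U y = coset U x \<Longrightarrow> coset V (F y) = coset V (F x)"
  shows "qmap V F (coset U x) = coset V (F x)"
  unfolding qmap_def
proof (rule the_elem_eq)
  show "coset V (F x) \<in> (\<lambda>x. coset V (F x)) ` coset U x"
    by (rule imageI) (rule coset_self[OF assms(1)])
  fix w
  assume "w \<in> (\<lambda>x. coset V (F x)) ` coset U x"
  then obtain y where "coset U y = coset U x" "w = coset V (F y)"
    by (auto simp only: mem_coset_iff[OF assms(1)])
  then show "w = coset V (F x)" using assms(2) by metis
qed

text \<open>Well-definedness is stated dually: pulling back along \<open>f\<close> carries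
  functionals that kill \<open>V\<close> to functionals that kill \<open>U\<close>.\<close>

lemma qmap_free_map:
  fixes V :: "('b \<Rightarrow>\<^sub>0 'k::field) set"
  assumes "free.subspace U" "free.subspace V"
    and "\<And>t. vanishes_on (*) V t \<Longrightarrow> vanishes_on (*) U (\<lambda>a. t (f a))"
  shows "qmap V (free_map f) (coset U x) = coset V (free_map f x)"
proof (rule qmap_coset[OF assms(1)], rule coset_eqI[OF assms(2)])
  fix y and t :: "'b \<Rightarrow> 'k"
  assume "coset U y = coset U x" and "vanishes_on (*) V t"
  then show "lin_ext (*) t (free_map f y) = lin_ext (*) t (free_map f x)"
    unfolding lin_ext_free_map[OF vector_space_mult]
    by (intro coset_eqD[OF assms(1) vector_space_mult] assms(3))
qed

lemma qscale_coset:
  assumes "free.subspace U"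
  shows "qscale U c (coset U x) = coset U (fscale c x)"
  unfolding qscale_def
proof (rule qmap_coset[OF assms])
  fix y
  assume "coset U y = coset U x"
  then show "coset U (fscale c y) = coset U (fscale c x)"
    using free.subspace_scale[OF assms, of "y - x" c]
    by (simp add: coset_eq_iff[OF assms] free.scale_right_diff_distrib)
qed

lemma qmap2_coset:
  assumes "free.subspace U" "free.subspace W"
    and "\<And>x' y'. coset U x' = coset U x \<Longrightarrow> coset W y' = coset W y \<Longrightarrow>
      coset V (F x' y') = coset V (F x y)"
  shows "qmap2 V F (coset U x) (coset W y) = coset V (F x y)"
  unfolding qmap2_def
proof (rule the_elem_eq)
  show "coset V (F x y) \<in> (\<lambda>(x, y). coset V (F x y)) ` (coset U x \<times> coset W y)"
    using coset_self[OF assms(1), of x] coset_self[OF assms(2), of y] by (intro image_eqI) auto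
next
  fix w
  assume "w \<in> (\<lambda>(x, y). coset V (F x y)) ` (coset U x \<times> coset W y)"
  then obtain x' y' where "x' \<in> coset U x" "y' \<in> coset W y" "w = coset V (F x' y')"
    by blast
  then show "w = coset V (F x y)"
    using assms(3)[of x' y'] mem_coset_iff[OF assms(1)] mem_coset_iff[OF assms(2)] by blast
qed

text \<open>The two conditions are deliberately asymmetric. The first representative is changed with
  \<open>b\<close> arbitrary, the second only after summation over the fixed \<open>x\<close>. The
  weaker second condition is what the product on the \<open>\<times>_R\<close> subspace and the
  action of \<open>e\<close> on \<open>H \<diamond> H\<close> satisfy.\<close>

lemma qmap2_free_map2:
  fixes V :: "('c \<Rightarrow>\<^sub>0 'k::field) set"
  assumes U: "free.subspace U" and W: "free.subspace W" and V: "free.subspace V"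
    and left: "\<And>t b. vanishes_on (*) V t \<Longrightarrow> vanishes_on (*) U (\<lambda>a. t (f a b))"
    and right: "\<And>t. vanishes_on (*) V t \<Longrightarrow>
      vanishes_on (*) W (\<lambda>b. lin_ext (*) (\<lambda>a. t (f a b)) x)"
  shows "qmap2 V (free_map2 f) (coset U x) (coset W y) = coset V (free_map2 f x y)"
proof (rule qmap2_coset[OF U W], rule coset_eqI[OF V])
  fix x' y' and t :: "'c \<Rightarrow> 'k"
  assume x': "coset U x' = coset U x" and y': "coset W y' = coset W y"
    and t: "vanishes_on (*) V t"
  let ?L = "lin_ext ((*) :: 'k \<Rightarrow> 'k \<Rightarrow> 'k)"
  have "?L t (free_map2 f x' y') = ?L (\<lambda>b. ?L (\<lambda>a. t (f a b)) x') y'"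
    by (simp add: lin_ext_free_map2[OF vector_space_mult] lin_ext_swap[OF vector_space_mult, of _ y'])
  also have "\<dots> = ?L (\<lambda>b. ?L (\<lambda>a. t (f a b)) x) y'"
    using coset_eqD[OF U vector_space_mult left[OF t] x'] by simp
  also have "\<dots> = ?L (\<lambda>b. ?L (\<lambda>a. t (f a b)) x) y"
    by (rule coset_eqD[OF W vector_space_mult right[OF t] y'])
  also have "\<dots> = ?L t (free_map2 f x y)"
    by (simp add: lin_ext_free_map2[OF vector_space_mult] lin_ext_swap[OF vector_space_mult, of _ y])
  finally show "?L t (free_map2 f x' y') = ?L t (free_map2 f x y)" .
qed

lemma qadd_coset:
  assumes "free.subspace U"
  shows "qadd U (coset U x) (coset U y) = coset U (x + y)"
  unfolding qadd_def
proof (rule qmap2_coset[OF assms assms])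
  fix x' y'
  assume "coset U x' = coset U x" "coset U y' = coset U y"
  then have "(x' - x) + (y' - y) \<in> U"
    by (intro free.subspace_add[OF assms]) (simp_all add: coset_eq_iff[OF assms])
  then show "coset U (x' + y') = coset U (x + y)"
    by (simp add: coset_eq_iff[OF assms] algebra_simps)
qed

lemma linear_into_quotI:
  fixes U :: "('a \<Rightarrow>\<^sub>0 'k::field) set"
  assumes U: "free.subspace U" and f: "\<And>v. f v = coset U (g v)"
    and lin: "\<And>t. vanishes_on (*) U t \<Longrightarrow> Vector_Spaces.linear s (*) (\<lambda>v. lin_ext (*) t (g v))"
  shows "linear_into_quot s U f"
proof -
  note L = lin_ext_add[OF vector_space_mult] lin_ext_fscale[OF vector_space_mult]
  have "coset U (g (v + w)) = coset U (g v + g w)" for v w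
    by (rule coset_eqI[OF U]) (use lin in \<open>simp add: Vector_Spaces.linear_iff L\<close>)
  moreover have "coset U (g (s c v)) = coset U (fscale c (g v))" for c v
    by (rule coset_eqI[OF U]) (use lin in \<open>simp add: Vector_Spaces.linear_iff L\<close>)
  ultimately show ?thesis
    by (simp add: linear_into_quot_def f quot_def qadd_coset[OF U] qscale_coset[OF U])
qed

text \<open>The choice \<open>g\<close> of representatives need not be linear, but its defect lies
  in \<open>U\<close>, where \<open>t\<close> vanishes.\<close>

lemma linear_into_quotD:
  fixes U :: "('a \<Rightarrow>\<^sub>0 'k::field) set"
  assumes U: "free.subspace U" and s: "vector_space s" and f: "\<And>v. f v = coset U (g v)"
    and lin: "linear_into_quot s U f" and t: "vanishes_on (*) U t"
  shows "Vector_Spaces.linear s (*) (\<lambda>v. lin_ext (*) t (g v))"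
proof -
  note L = lin_ext_add[OF vector_space_mult] lin_ext_fscale[OF vector_space_mult]
  note D = coset_eqD[OF U vector_space_mult t]
  have add: "coset U (g (v + w)) = coset U (g v + g w)" for v w
    using lin by (simp add: linear_into_quot_def f qadd_coset[OF U])
  have scale: "coset U (g (s c v)) = coset U (fscale c (g v))" for c v
    using lin by (simp add: linear_into_quot_def f qscale_coset[OF U])
  show ?thesis
    unfolding Vector_Spaces.linear_iff
    by (intro conjI allI s vector_space_mult) (simp_all only: D[OF add] D[OF scale] L)
qed

text \<open>Common core of the two lemmas below: the set ranges over a representative of the
  argument and over a simultaneous choice of representatives for all values of \<open>f\<close>, so
  independence is required in both at once.\<close>

lemma the_elem_representatives:
  assumes U: "free.subspace U" and W: "free.subspace W" and f: "\<And>a. f a = coset W (g a)"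
    and F: "\<And>y h. coset U y = coset U x \<Longrightarrow> (\<And>a. coset W (h a) = coset W (g a)) \<Longrightarrow> F h y = F g x"
  shows "the_elem {F h y | y h. y \<in> coset U x \<and> (\<forall>a. h a \<in> f a)} = F g x"
proof (rule the_elem_eq)
  show "F g x \<in> {F h y | y h. y \<in> coset U x \<and> (\<forall>a. h a \<in> f a)}"
    using coset_self[OF U] coset_self[OF W] by (auto simp only: f)
next
  fix w
  assume "w \<in> {F h y | y h. y \<in> coset U x \<and> (\<forall>a. h a \<in> f a)}"
  then obtain h y where "w = F h y" "y \<in> coset U x" "\<And>a. h a \<in> coset W (g a)"
    unfolding f by blast
  then show "w = F g x"
    by (simp only: mem_coset_iff[OF U] mem_coset_iff[OF W]) (rule F)
qed

text \<open>\<open>inner\<close> absorbs a change of the choice function \<open>g\<close>;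
  \<open>outer\<close> then absorbs a change of the representative \<open>x\<close> with
  \<open>g\<close> fixed.\<close>

lemma map_left_coset:
  fixes V :: "('a \<times> 'a \<times> 'a \<Rightarrow>\<^sub>0 'k::field) set"
  assumes U: "free.subspace U" and W: "free.subspace W" and V: "free.subspace V"
    and f: "\<And>a. f a = coset W (g a)"
    and inner: "\<And>t b. vanishes_on (*) V t \<Longrightarrow> vanishes_on (*) W (\<lambda>(p, q). t (p, q, b))"
    and outer: "\<And>t. vanishes_on (*) V t \<Longrightarrow>
      vanishes_on (*) U (\<lambda>(a, b). lin_ext (*) (\<lambda>(p, q). t (p, q, b)) (g a))"
  shows "map_left V f (coset U x)
    = coset V (lin_ext fscale (\<lambda>(a, b). free_map (\<lambda>(p, q). (p, q, b)) (g a)) x)"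
proof -
  let ?F = "\<lambda>g. lin_ext fscale (\<lambda>(a, b). free_map (\<lambda>(p, q). (p, q, b)) (g a))"
  let ?L = "lin_ext ((*) :: 'k \<Rightarrow> 'k \<Rightarrow> 'k)"
  have ev: "?L t (?F h y) = ?L (\<lambda>(a, b). ?L (\<lambda>(p, q). t (p, q, b)) (h a)) y" for t h y
    by (simp add: lin_ext_lin_ext[OF vector_space_mult] lin_ext_free_map[OF vector_space_mult]
        case_prod_unfold)
  have "coset V (?F h y) = coset V (?F g x)"
    if y: "coset U y = coset U x" and h: "\<And>a. coset W (h a) = coset W (g a)" for h y
  proof (rule coset_eqI[OF V])
    fix t :: "'a \<times> 'a \<times> 'a \<Rightarrow> 'k"
    assume t: "vanishes_on (*) V t"
    have "?L (\<lambda>(p, q). t (p, q, b)) (h a) = ?L (\<lambda>(p, q). t (p, q, b)) (g a)" for a b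
      by (rule coset_eqD[OF W vector_space_mult inner[OF t] h])
    then have "?L t (?F h y) = ?L (\<lambda>(a, b). ?L (\<lambda>(p, q). t (p, q, b)) (g a)) y"
      by (simp only: ev)
    also have "\<dots> = ?L t (?F g x)"
      unfolding ev by (rule coset_eqD[OF U vector_space_mult outer[OF t] y])
    finally show "?L t (?F h y) = ?L t (?F g x)" .
  qed
  then show ?thesis
    unfolding map_left_def
    by (rule the_elem_representatives[OF U W f, where F = "\<lambda>h y. coset V (?F h y)"])
qed

lemma map_right_coset:
  fixes V :: "('a \<times> 'a \<times> 'a \<Rightarrow>\<^sub>0 'k::field) set"
  assumes U: "free.subspace U" and W: "free.subspace W" and V: "free.subspace V"
    and f: "\<And>a. f a = coset W (g a)"
    and inner: "\<And>t a. vanishes_on (*) V t \<Longrightarrow> vanishes_on (*) W (\<lambda>(p, q). t (a, p, q))"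
    and outer: "\<And>t. vanishes_on (*) V t \<Longrightarrow>
      vanishes_on (*) U (\<lambda>(a, b). lin_ext (*) (\<lambda>(p, q). t (a, p, q)) (g b))"
  shows "map_right V f (coset U x)
    = coset V (lin_ext fscale (\<lambda>(a, b). free_map (\<lambda>(p, q). (a, p, q)) (g b)) x)"
proof -
  let ?F = "\<lambda>g. lin_ext fscale (\<lambda>(a, b). free_map (\<lambda>(p, q). (a, p, q)) (g b))"
  let ?L = "lin_ext ((*) :: 'k \<Rightarrow> 'k \<Rightarrow> 'k)"
  have ev: "?L t (?F h y) = ?L (\<lambda>(a, b). ?L (\<lambda>(p, q). t (a, p, q)) (h b)) y" for t h y
    by (simp add: lin_ext_lin_ext[OF vector_space_mult] lin_ext_free_map[OF vector_space_mult]
        case_prod_unfold)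
  have "coset V (?F h y) = coset V (?F g x)"
    if y: "coset U y = coset U x" and h: "\<And>a. coset W (h a) = coset W (g a)" for h y
  proof (rule coset_eqI[OF V])
    fix t :: "'a \<times> 'a \<times> 'a \<Rightarrow> 'k"
    assume t: "vanishes_on (*) V t"
    have "?L (\<lambda>(p, q). t (a, p, q)) (h b) = ?L (\<lambda>(p, q). t (a, p, q)) (g b)" for a b
      by (rule coset_eqD[OF W vector_space_mult inner[OF t] h])
    then have "?L t (?F h y) = ?L (\<lambda>(a, b). ?L (\<lambda>(p, q). t (a, p, q)) (g b)) y"
      by (simp only: ev)
    also have "\<dots> = ?L t (?F g x)"
      unfolding ev by (rule coset_eqD[OF U vector_space_mult outer[OF t] y])
    finally show "?L t (?F h y) = ?L t (?F g x)" .
  qed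
  then show ?thesis
    unfolding map_right_def
    by (rule the_elem_representatives[OF U W f, where F = "\<lambda>h y. coset V (?F h y)"])
qed

section \<open>Functionals on tensor products\<close>

text \<open>Uncurried, because test functions are functions on the generators, which are
  pairs.\<close>

definition bilinear ::
    "('k::field \<Rightarrow> 'a::ab_group_add \<Rightarrow> 'a) \<Rightarrow> ('k \<Rightarrow> 'v::ab_group_add \<Rightarrow> 'v) \<Rightarrow> ('a \<times> 'a \<Rightarrow> 'v) \<Rightarrow> bool"
  where
  "bilinear sA s t \<longleftrightarrow>
    (\<forall>b. Vector_Spaces.linear sA s (\<lambda>a. t (a, b))) \<and> (\<forall>a. Vector_Spaces.linear sA s (\<lambda>b. t (a, b)))"

definition trilinear ::
    "('k::field \<Rightarrow> 'a::ab_group_add \<Rightarrow> 'a) \<Rightarrow> ('k \<Rightarrow> 'v::ab_group_add \<Rightarrow> 'v) \<Rightarrow>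
      ('a \<times> 'a \<times> 'a \<Rightarrow> 'v) \<Rightarrow> bool"
  where
  "trilinear sA s t \<longleftrightarrow>
    (\<forall>b c. Vector_Spaces.linear sA s (\<lambda>a. t (a, b, c))) \<and>
    (\<forall>a c. Vector_Spaces.linear sA s (\<lambda>b. t (a, b, c))) \<and>
    (\<forall>a b. Vector_Spaces.linear sA s (\<lambda>c. t (a, b, c)))"

lemma vanishes_on_Un: "vanishes_on s (A \<union> B) t \<longleftrightarrow> vanishes_on s A t \<and> vanishes_on s B t"
  by (auto simp: vanishes_on_def)

lemma ball_range3: "(\<forall>u\<in>{f a b c | a b c. True}. P u) \<longleftrightarrow> (\<forall>a b c. P (f a b c))"
  and ball_range4: "(\<forall>u\<in>{g a b c d | a b c d. True}. P u) \<longleftrightarrow> (\<forall>a b c d. P (g a b c d))"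
  by blast+

lemma vanishes_on_bilinear_relators:
  assumes "vector_space sA" "vector_space s"
  shows "vanishes_on s (bilinear_relators sA sA) t \<longleftrightarrow> bilinear sA s t"
proof -
  interpret Vector_Spaces.linear fscale s "lin_ext s t" by (rule linear_lin_ext[OF assms(2)])
  note ev = vanishes_on_def ball_range3 ball_range4 add diff scale lin_ext_basis[OF assms(2)]
    diff_diff_eq right_minus_eq
  have "vanishes_on s (bilinear_relators sA sA) t \<longleftrightarrow>
    (\<forall>a a' b. t (a + a', b) = t (a, b) + t (a', b)) \<and>
    (\<forall>a b b'. t (a, b + b') = t (a, b) + t (a, b')) \<and>
    (\<forall>c a b. t (sA c a, b) = s c (t (a, b))) \<and> (\<forall>c a b. t (a, sA c b) = s c (t (a, b)))"
    unfolding bilinear_relators_def vanishes_on_Un by (simp only: ev conj_assoc)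
  also have "\<dots> \<longleftrightarrow> bilinear sA s t"
    by (simp add: bilinear_def Vector_Spaces.linear_iff assms) blast
  finally show ?thesis .
qed

lemma vanishes_on_trilinear_relators:
  assumes "vector_space sA" "vector_space s"
  shows "vanishes_on s (trilinear_relators sA) t \<longleftrightarrow> trilinear sA s t"
proof -
  interpret Vector_Spaces.linear fscale s "lin_ext s t" by (rule linear_lin_ext[OF assms(2)])
  note ev = vanishes_on_def ball_range3 ball_range4 add diff scale lin_ext_basis[OF assms(2)]
    diff_diff_eq right_minus_eq
  have "vanishes_on s (trilinear_relators sA) t \<longleftrightarrow>
    (\<forall>a a' b c. t (a + a', b, c) = t (a, b, c) + t (a', b, c)) \<and>
    (\<forall>a b b' c. t (a, b + b', c) = t (a, b, c) + t (a, b', c)) \<and>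
    (\<forall>a b c c'. t (a, b, c + c') = t (a, b, c) + t (a, b, c')) \<and>
    (\<forall>a b c d. t (sA d a, b, c) = s d (t (a, b, c))) \<and>
    (\<forall>a b c d. t (a, sA d b, c) = s d (t (a, b, c))) \<and>
    (\<forall>a b c d. t (a, b, sA d c) = s d (t (a, b, c)))"
    unfolding trilinear_relators_def vanishes_on_Un by (simp only: ev conj_assoc)
  also have "\<dots> \<longleftrightarrow> trilinear sA s t"
    by (simp add: trilinear_def Vector_Spaces.linear_iff assms)
      (intro iffI conjI allI; elim conjE; simp)
  finally show ?thesis .
qed

text \<open>The universal property of the tensor product; it makes the test functionals of
  \<open>coset_eqI\<close> explicit.\<close>

lemma vanishes_on_tensor2:
  assumes "vector_space sA" "vector_space s"
  shows "vanishes_on s (tensor2 sA) t \<longleftrightarrow> bilinear sA s t"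
  by (simp add: tensor2_def vanishes_on_span[OF assms(2)] vanishes_on_bilinear_relators[OF assms])

lemma vanishes_on_tensor3:
  assumes "vector_space sA" "vector_space s"
  shows "vanishes_on s (tensor3 sA) t \<longleftrightarrow> trilinear sA s t"
  by (simp add: tensor3_def vanishes_on_span[OF assms(2)] vanishes_on_trilinear_relators[OF assms])

lemma vanishes_on_diamond2:
  assumes "vector_space sL" "vector_space s"
  shows "vanishes_on s (diamond2 sR sL \<iota>) t \<longleftrightarrow> bilinear sL s t \<and>
    (\<forall>r m n. t (inRbar sR \<iota> r * m, n) = t (m, inR sR \<iota> r * n))"
proof -
  interpret Vector_Spaces.linear fscale s "lin_ext s t" by (rule linear_lin_ext[OF assms(2)])
  show ?thesis
    unfolding diamond2_def vanishes_on_span[OF assms(2)] vanishes_on_Un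
      vanishes_on_bilinear_relators[OF assms]
    by (simp only: vanishes_on_def ball_range3 ball_range4 diff lin_ext_basis[OF assms(2)]
        right_minus_eq conj_assoc)
qed

lemma vanishes_on_diamond3:
  assumes "vector_space sL" "vector_space s"
  shows "vanishes_on s (diamond3 sR sL \<iota>) t \<longleftrightarrow> trilinear sL s t \<and>
    (\<forall>r m n p. t (inRbar sR \<iota> r * m, n, p) = t (m, inR sR \<iota> r * n, p)) \<and>
    (\<forall>r m n p. t (m, inRbar sR \<iota> r * n, p) = t (m, n, inR sR \<iota> r * p))"
proof -
  interpret Vector_Spaces.linear fscale s "lin_ext s t" by (rule linear_lin_ext[OF assms(2)])
  show ?thesis
    unfolding diamond3_def vanishes_on_span[OF assms(2)] vanishes_on_Un
      vanishes_on_trilinear_relators[OF assms]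
    by (simp only: vanishes_on_def ball_range3 ball_range4 diff lin_ext_basis[OF assms(2)]
        right_minus_eq conj_assoc)
qed

lemma subspace_tensor2: "free.subspace (tensor2 sA)"
  and subspace_tensor3: "free.subspace (tensor3 sA)"
  and subspace_diamond2: "free.subspace (diamond2 sR sL \<iota>)"
  and subspace_diamond3: "free.subspace (diamond3 sR sL \<iota>)"
  unfolding tensor2_def tensor3_def diamond2_def diamond3_def by (rule free.subspace_span)+

section \<open>Linear maps\<close>

text \<open>Nearly every side condition asks that an explicit term be linear in one variable; these
  rules decompose the term syntactically.\<close>

named_theorems linear_intros

lemma linear_ident [linear_intros]: "vector_space s \<Longrightarrow> Vector_Spaces.linear s s (\<lambda>x. x)"
  by (simp add: Vector_Spaces.linear_iff)

lemma linear_case_prod [linear_intros]: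
  assumes "\<And>a b. Vector_Spaces.linear s s' (\<lambda>x. f x a b)"
  shows "Vector_Spaces.linear s s' (\<lambda>x. case p of (a, b) \<Rightarrow> f x a b)"
  using assms by (cases p) simp

text \<open>Complements \<open>linear_lin_ext\<close>: here the variable sits in the integrand, and
  the value is a finite linear combination of the linear maps \<open>f _ a\<close>.\<close>

lemma linear_lin_ext_integrand [linear_intros]:
  assumes "\<And>a. Vector_Spaces.linear s s' (\<lambda>x. f x a)"
  shows "Vector_Spaces.linear s s' (\<lambda>x. lin_ext s' (f x) y)"
proof -
  interpret vector_space s'
    using assms by (simp add: Vector_Spaces.linear_iff)
  show ?thesis
    using assms
    by (simp add: Vector_Spaces.linear_iff lin_ext_def scale_right_distrib sum.distrib
        scale_sum_right mult.commute)
qed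

lemma linear_compose_fun:
  assumes "Vector_Spaces.linear s' s'' G" "Vector_Spaces.linear s s' F"
  shows "Vector_Spaces.linear s s'' (\<lambda>x. G (F x))"
  using assms by (simp add: Vector_Spaces.linear_iff)

lemma linear_bilinear_left:
  assumes "bilinear sA s t" "Vector_Spaces.linear s' sA F"
  shows "Vector_Spaces.linear s' s (\<lambda>x. t (F x, b))"
  using assms linear_compose_fun[of sA s "\<lambda>a. t (a, b)"] by (simp add: bilinear_def)

lemma linear_bilinear_right:
  assumes "bilinear sA s t" "Vector_Spaces.linear s' sA F"
  shows "Vector_Spaces.linear s' s (\<lambda>x. t (a, F x))"
  using assms linear_compose_fun[of sA s "\<lambda>b. t (a, b)"] by (simp add: bilinear_def)

lemma linear_trilinear:
  assumes "trilinear sA s t" "Vector_Spaces.linear s' sA F"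
  shows "Vector_Spaces.linear s' s (\<lambda>x. t (F x, b, c))"
    and "Vector_Spaces.linear s' s (\<lambda>x. t (a, F x, c))"
    and "Vector_Spaces.linear s' s (\<lambda>x. t (a, b, F x))"
  using assms linear_compose_fun[of sA s "\<lambda>a. t (a, b, c)"]
    linear_compose_fun[of sA s "\<lambda>b. t (a, b, c)"] linear_compose_fun[of sA s "\<lambda>c. t (a, b, c)"]
  by (simp_all add: trilinear_def)

lemma k_algebra_mult: "k_algebra ((*) :: 'k::field \<Rightarrow> 'k \<Rightarrow> 'k)"
  by (intro k_algebra.intro vector_space_mult k_algebra_axioms.intro) (auto simp: algebra_simps)

context k_algebra
begin

lemma linear_mult_left:
  assumes "Vector_Spaces.linear s scale F"
  shows "Vector_Spaces.linear s scale (\<lambda>x. F x * c)"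
  using assms by (simp add: Vector_Spaces.linear_iff distrib_right scale_mult_left)

lemma linear_mult_right:
  assumes "Vector_Spaces.linear s scale F"
  shows "Vector_Spaces.linear s scale (\<lambda>x. c * F x)"
  using assms by (simp add: Vector_Spaces.linear_iff distrib_left scale_mult_right)

lemma linear_scale_left:
  assumes "Vector_Spaces.linear s (*) F"
  shows "Vector_Spaces.linear s scale (\<lambda>x. scale (F x) c)"
  using assms vector_space_axioms by (simp add: Vector_Spaces.linear_iff scale_left_distrib)

lemma linear_scale_right:
  assumes "Vector_Spaces.linear s scale F"
  shows "Vector_Spaces.linear s scale (\<lambda>x. scale c (F x))"
  using assms
  by (simp add: Vector_Spaces.linear_iff scale_right_distrib scale_left_commute)

end

lemmas [linear_intros] =
  k_algebra.linear_mult_left[OF k_algebra_mult] k_algebra.linear_mult_right[OF k_algebra_mult]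

lemma free_map2_basis: "free_map2 f (basis a) (basis b) = basis (f a b)"
  by (simp add: free_map2_def free_map_def lin_ext_basis free.vector_space_axioms)

lemma free_map_basis: "free_map f (basis a) = basis (f a)"
  by (simp add: free_map_def lin_ext_basis free.vector_space_axioms)

section \<open>The weak bialgebra\<close>

locale frobenius_timesR_bialgebra =
  fixes sR :: "'k::field \<Rightarrow> 'r::{ring, monoid_mult} \<Rightarrow> 'r"
    and sH :: "'k \<Rightarrow> 'h::{ring, monoid_mult} \<Rightarrow> 'h"
    and \<phi> :: "'r \<Rightarrow> 'k"
    and e :: "('r \<times> 'r \<Rightarrow>\<^sub>0 'k) set"
    and \<iota> :: "('r \<times> 'r \<Rightarrow>\<^sub>0 'k) set \<Rightarrow> 'h"
    and \<Gamma> :: "'h \<Rightarrow> ('h \<times> 'h \<Rightarrow>\<^sub>0 'k) set"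
    and C :: "'h \<Rightarrow> 'r \<Rightarrow> 'r"
  assumes frobenius: "idempotent_frobenius_system sR \<phi> e"
    and bialgebra: "timesR_bialgebra sR sH \<iota> \<Gamma> C"
begin

abbreviation "i \<equiv> inR sR \<iota>"
abbreviation "j \<equiv> inRbar sR \<iota>"
abbreviation "L \<equiv> lin_ext ((*) :: 'k \<Rightarrow> 'k \<Rightarrow> 'k)"

definition "e0 = (SOME x. e = coset (tensor2 sR) x)"
definition "\<gamma> h = (SOME x. \<Gamma> h = coset (diamond2 sR sH \<iota>) x)"

lemma Re_ring: "Re_ring sR sH \<iota>"
  and \<Gamma>_hom: "Re_ring_hom_timesR sR sH \<iota> \<Gamma>"
  and C_hom: "Re_ring_hom_End sR sH \<iota> C"
  using bialgebra by (auto simp: timesR_bialgebra_def)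

sublocale R: k_algebra sR using Re_ring by (simp add: Re_ring_def)
sublocale H: k_algebra sH using Re_ring by (simp add: Re_ring_def)

lemmas vector_spaces =
  vector_space_mult[where 'k = 'k] R.vector_space_axioms H.vector_space_axioms

lemmas algebra_linear_intros =
  R.linear_mult_left R.linear_mult_right R.linear_scale_left R.linear_scale_right
  H.linear_mult_left H.linear_mult_right H.linear_scale_left H.linear_scale_right

lemmas swap = lin_ext_swap_pairs[OF vector_space_mult[where 'k = 'k]]

lemma e_eq: "e = coset (tensor2 sR) e0"
proof -
  have "\<exists>x. e = coset (tensor2 sR) x"
    using frobenius by (auto simp: idempotent_frobenius_system_def frobenius_system_def quot_def)
  then show ?thesis unfolding e0_def by (rule someI_ex)
qed

lemma \<Gamma>_eq: "\<Gamma> h = coset (diamond2 sR sH \<iota>) (\<gamma> h)"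
proof -
  have "\<Gamma> h \<in> quot (diamond2 sR sH \<iota>)"
    using \<Gamma>_hom by (simp add: Re_ring_hom_timesR_def linear_into_quot_def)
  then have "\<exists>x. \<Gamma> h = coset (diamond2 sR sH \<iota>) x" by (auto simp: quot_def)
  then show ?thesis unfolding \<gamma>_def by (rule someI_ex)
qed

section \<open>The Frobenius identities and the Casimir property\<close>

lemma \<phi>_linear: "Vector_Spaces.linear sR (*) \<phi>"
  using frobenius by (auto simp: idempotent_frobenius_system_def frobenius_system_def)

lemmas linear_\<phi> = linear_compose_fun[OF \<phi>_linear]

lemma qlift_e:
  assumes "vector_space s" "bilinear sR s f"
  shows "qlift s f e = lin_ext s f e0"
proof -
  have "qlift s f (coset (tensor2 sR) e0) = lin_ext s f e0"
    using assms
    by (intro qlift_coset subspace_tensor2)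
      (simp_all only: vanishes_on_tensor2[OF R.vector_space_axioms])
  then show ?thesis by (simp only: e_eq[symmetric])
qed

lemma frob1: "lin_ext sR (\<lambda>(a, b). sR (\<phi> (r * a)) b) e0 = r"
proof -
  have "bilinear sR sR (\<lambda>(a, b). sR (\<phi> (r * a)) b)"
    unfolding bilinear_def split
    by (intro conjI allI linear_intros algebra_linear_intros linear_\<phi> vector_spaces)
  from qlift_e[OF R.vector_space_axioms this] show ?thesis
    using frobenius by (simp add: idempotent_frobenius_system_def frobenius_system_def)
qed

lemma frob2: "lin_ext sR (\<lambda>(a, b). sR (\<phi> (b * r)) a) e0 = r"
proof -
  have "bilinear sR sR (\<lambda>(a, b). sR (\<phi> (b * r)) a)"
    unfolding bilinear_def split
    by (intro conjI allI linear_intros algebra_linear_intros linear_\<phi> vector_spaces)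
  from qlift_e[OF R.vector_space_axioms this] show ?thesis
    using frobenius by (simp add: idempotent_frobenius_system_def frobenius_system_def)
qed

lemma idem: "lin_ext sR (\<lambda>(a, b). a * b) e0 = 1"
proof -
  have "bilinear sR sR (\<lambda>(a, b). a * b)"
    unfolding bilinear_def split
    by (intro conjI allI linear_intros algebra_linear_intros vector_spaces)
  from qlift_e[OF R.vector_space_axioms this] show ?thesis
    using frobenius by (simp add: idempotent_frobenius_system_def)
qed

text \<open>Take a second copy \<open>(p', q')\<close> of \<open>e\<close>. Expanding
  \<open>r * p\<close> by \<open>frob2\<close> in that copy, or \<open>q' * r\<close> by
  \<open>frob1\<close> in the original one, gives the same double sum of
  \<open>\<phi> (q' * r * p)\<close> times \<open>b (p', q)\<close>.\<close>

lemma casimir: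
  assumes s: "vector_space s" and b: "bilinear sR s b"
  shows "lin_ext s (\<lambda>(p, q). b (r * p, q)) e0 = lin_ext s (\<lambda>(p, q). b (p, q * r)) e0"
proof -
  interpret s: vector_space s by fact
  note bl = linear_bilinear_left[OF b linear_ident[OF R.vector_space_axioms]]
    and br = linear_bilinear_right[OF b linear_ident[OF R.vector_space_axioms]]
  have bl': "s c (b (x, y)) = b (sR c x, y)" for c x y
    using bl[of y] by (simp add: Vector_Spaces.linear_iff)
  have br': "s c (b (x, y)) = b (x, sR c y)" for c x y
    using br[of x] by (simp add: Vector_Spaces.linear_iff)
  have "b (r * p, q) = lin_ext s (\<lambda>(p', q'). s (\<phi> (q' * (r * p))) (b (p', q))) e0" for p q
    using linear_lin_ext_apply[OF bl[of q], of "\<lambda>(a, b). sR (\<phi> (b * (r * p))) a" e0]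
    by (simp add: frob2[unfolded case_prod_unfold] bl' case_prod_unfold)
  then have "lin_ext s (\<lambda>(p, q). b (r * p, q)) e0
    = lin_ext s (\<lambda>(p', q'). lin_ext s (\<lambda>(p, q). s (\<phi> (q' * r * p)) (b (p', q))) e0) e0"
    by (simp add: case_prod_unfold mult.assoc) (rule lin_ext_swap[OF s])
  moreover have "b (p', q' * r) = lin_ext s (\<lambda>(p, q). s (\<phi> (q' * r * p)) (b (p', q))) e0"
    for p' q'
    using linear_lin_ext_apply[OF br[of p'], of "\<lambda>(a, b). sR (\<phi> (q' * r * a)) b" e0]
    by (simp add: frob1[unfolded case_prod_unfold] br' case_prod_unfold)
  ultimately show ?thesis by simp
qed

section \<open>The images of \<open>R\<close> and its opposite in \<open>H\<close>, and the action
  \<open>C\<close>\<close>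

definition k where "k r q = \<iota> (coset (tensor2 sR) (basis (r, q)))"

lemma i_k: "i r = k r 1" and j_k: "j q = k 1 q"
  by (simp_all add: inR_def inRbar_def k_def)

lemma tensor2_eqI:
  assumes "\<And>t. bilinear sR (*) t \<Longrightarrow> L t x = L t y"
  shows "coset (tensor2 sR) x = coset (tensor2 sR) y"
  using assms
  by (intro coset_eqI) (auto simp: vanishes_on_tensor2 subspace_tensor2 vector_spaces)

lemma k_linear: "Vector_Spaces.linear sR sH (\<lambda>r. k r q)" "Vector_Spaces.linear sR sH (k r)"
proof -
  have add: "\<iota> (coset (tensor2 sR) (x + y)) = \<iota> (coset (tensor2 sR) x) + \<iota> (coset (tensor2 sR) y)" for x y
    using Re_ring by (auto simp: Re_ring_def quot_def qadd_coset[OF subspace_tensor2])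
  have scale: "\<iota> (coset (tensor2 sR) (fscale c x)) = sH c (\<iota> (coset (tensor2 sR) x))" for c x
    using Re_ring by (auto simp: Re_ring_def quot_def qscale_coset[OF subspace_tensor2])
  note ev = bilinear_def Vector_Spaces.linear_iff lin_ext_add lin_ext_fscale lin_ext_basis
    vector_spaces
  have "coset (tensor2 sR) (basis (r + r', q)) = coset (tensor2 sR) (basis (r, q) + basis (r', q))"
    "coset (tensor2 sR) (basis (q, r + r')) = coset (tensor2 sR) (basis (q, r) + basis (q, r'))"
    "coset (tensor2 sR) (basis (sR c r, q)) = coset (tensor2 sR) (fscale c (basis (r, q)))"
    "coset (tensor2 sR) (basis (q, sR c r)) = coset (tensor2 sR) (fscale c (basis (q, r)))"
    for r r' q c
    by (rule tensor2_eqI; simp add: ev)+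
  then show "Vector_Spaces.linear sR sH (\<lambda>r. k r q)" "Vector_Spaces.linear sR sH (k r)"
    by (simp_all add: Vector_Spaces.linear_iff vector_spaces k_def add scale)
qed

text \<open>The second product is reversed because that leg lives in the opposite algebra.\<close>

lemma k_mult: "k r q * k r' q' = k (r * r') (q' * q)"
proof -
  have "qmap2 (tensor2 sR) Re_mult (coset (tensor2 sR) (basis (r, q)))
      (coset (tensor2 sR) (basis (r', q')))
    = coset (tensor2 sR) (basis (r * r', q' * q))"
    unfolding Re_mult_def
    by (subst qmap2_free_map2)
      (auto simp: vanishes_on_tensor2 subspace_tensor2 vector_spaces free_map2_basis bilinear_def
        lin_ext_basis split: prod.splits
        intro!: linear_bilinear_left[of sR _ t for t] linear_bilinear_right[of sR _ t for t]
          algebra_linear_intros linear_ident)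
  then show ?thesis
    using Re_ring by (auto simp: Re_ring_def quot_def k_def) metis
qed

lemma k_1: "k 1 1 = 1"
  using Re_ring by (auto simp: Re_ring_def k_def)

text \<open>All are instances of \<open>k_mult\<close>; in particular \<open>i\<close> and
  \<open>j\<close> commute because both products equal \<open>k r q\<close>.\<close>

lemma i_1 [simp]: "i 1 = 1" and j_1 [simp]: "j 1 = 1"
  and i_mult: "i (r * r') = i r * i r'" and j_mult: "j (q * q') = j q' * j q"
  and k_eq: "k r q = i r * j q" and i_j: "i r * j q = j q * i r"
  by (simp_all add: i_k j_k k_1 k_mult)

lemma i_linear: "Vector_Spaces.linear sR sH i" and j_linear: "Vector_Spaces.linear sR sH j"
  using k_linear by (simp_all add: i_k[abs_def] j_k[abs_def])

lemma i_j_assoc: "i r * (j q * x) = j q * (i r * x)"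
  by (simp add: i_j mult.assoc[symmetric])

lemma C_linear: "Vector_Spaces.linear sR sR (C l)"
  and C_linear_left: "Vector_Spaces.linear sH sR (\<lambda>l. C l t)"
  and C_mult: "C (l * m) t = C l (C m t)"
  and C_1: "C 1 t = t"
  using C_hom by (auto simp: Re_ring_hom_End_def Vector_Spaces.linear_iff vector_spaces)

lemma C_k: "C (k r q) t = r * t * q"
proof -
  have "bilinear sR sR (\<lambda>(r, q). r * t * q)"
    unfolding bilinear_def prod.case
    by (intro conjI allI linear_intros algebra_linear_intros vector_spaces)
  then have "qlift sR (\<lambda>(r, q). r * t * q) (coset (tensor2 sR) (basis (r, q))) = r * t * q"
    by (subst qlift_coset)
      (simp_all add: subspace_tensor2 vanishes_on_tensor2 vector_spaces lin_ext_basis)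
  then show ?thesis
    using C_hom by (simp add: Re_ring_hom_End_def k_def quot_def)
qed

lemma C_i: "C (i r) t = r * t" and C_j: "C (j q) t = t * q"
  by (simp_all add: i_k j_k C_k)

lemmas linear_structure =
  linear_\<phi> linear_compose_fun[OF i_linear] linear_compose_fun[OF j_linear]
  linear_compose_fun[OF C_linear] linear_compose_fun[OF C_linear_left]

lemmas linearity = linear_intros algebra_linear_intros linear_structure vector_spaces

section \<open>Evaluating \<open>\<Gamma>\<close> against balanced functionals\<close>

definition balanced where
  "balanced s t \<longleftrightarrow> bilinear sH s t \<and> (\<forall>r m n. t (j r * m, n) = t (m, i r * n))"

definition balanced3 where
  "balanced3 t \<longleftrightarrow> trilinear sH (*) t \<and>
    (\<forall>r m n p. t (j r * m, n, p) = t (m, i r * n, p)) \<and>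
    (\<forall>r m n p. t (m, j r * n, p) = t (m, n, i r * p))"

text \<open>Values in a general space are kept, since the counit identities take values in
  \<open>H\<close> itself.\<close>

lemma vanishes_on_diamond2_iff:
  "vector_space s \<Longrightarrow> vanishes_on s (diamond2 sR sH \<iota>) t \<longleftrightarrow> balanced s t"
  by (simp add: vanishes_on_diamond2[OF H.vector_space_axioms] balanced_def)

lemma vanishes_on_diamond3_iff:
  "vanishes_on (*) (diamond3 sR sH \<iota>) t \<longleftrightarrow> balanced3 t"
  by (simp add: vanishes_on_diamond3[OF H.vector_space_axioms vector_space_mult] balanced3_def)

lemma vanishes_on_tensor2_iff:
  "vector_space s \<Longrightarrow> vanishes_on s (tensor2 sH) t \<longleftrightarrow> bilinear sH s t"
  by (rule vanishes_on_tensor2[OF H.vector_space_axioms])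

lemma vanishes_on_tensor3_iff:
  "vanishes_on (*) (tensor3 sH) t \<longleftrightarrow> trilinear sH (*) t"
  by (rule vanishes_on_tensor3[OF H.vector_space_axioms vector_space_mult])

lemmas vanishes_iff =
  vanishes_on_diamond2_iff[OF vector_space_mult] vanishes_on_diamond3_iff
  vanishes_on_tensor2_iff[OF vector_space_mult] vanishes_on_tensor3_iff
  vanishes_on_tensor2[OF R.vector_space_axioms vector_space_mult]

lemma \<gamma>_eval:
  assumes "\<Gamma> h = coset (diamond2 sR sH \<iota>) x" "balanced (*) t"
  shows "L t (\<gamma> h) = L t x"
  using assms(1)
  by (intro coset_eqD[OF subspace_diamond2 vector_space_mult])
    (simp_all only: vanishes_iff assms(2) \<Gamma>_eq)

lemma linear_\<gamma>:
  assumes "balanced (*) t" "Vector_Spaces.linear s sH F"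
  shows "Vector_Spaces.linear s (*) (\<lambda>x. L t (\<gamma> (F x)))"
proof (rule linear_compose_fun[OF _ assms(2)])
  show "Vector_Spaces.linear sH (*) (\<lambda>h. L t (\<gamma> h))"
    by (rule linear_into_quotD[OF subspace_diamond2 H.vector_space_axioms \<Gamma>_eq])
      (use \<Gamma>_hom assms(1) in \<open>simp_all add: Re_ring_hom_timesR_def vanishes_iff\<close>)
qed

text \<open>This is the membership of \<open>\<Gamma> h\<close> in the \<open>\<times>_R\<close>
  subspace, read through functionals. Both right multiplications descend to
  \<open>H \<diamond> H\<close> because they commute with the left actions that define it.\<close>

lemma \<gamma>_timesR:
  assumes t: "balanced (*) t"
  shows "L (\<lambda>(m, n). t (m * j q, n)) (\<gamma> h) = L (\<lambda>(m, n). t (m, n * i q)) (\<gamma> h)"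
proof -
  let ?D = "diamond2 sR sH \<iota>"
  let ?l = "\<lambda>(m, n). (m * j q, n)" and ?r = "\<lambda>(m, n). (m, n * i q)"
  have "balanced (*) (\<lambda>p. u (?l p))" "balanced (*) (\<lambda>p. u (?r p))" if "balanced (*) u" for u
  proof -
    have b: "bilinear sH (*) u" using that by (simp add: balanced_def)
    show "balanced (*) (\<lambda>p. u (?l p))" "balanced (*) (\<lambda>p. u (?r p))"
      unfolding balanced_def bilinear_def prod.case
      using that
      by (intro conjI allI linear_bilinear_left[OF b] linear_bilinear_right[OF b] linearity;
          simp add: balanced_def mult.assoc)+
  qed
  then have "qmap ?D (free_map ?l) (coset ?D (\<gamma> h)) = coset ?D (free_map ?l (\<gamma> h))"
    "qmap ?D (free_map ?r) (coset ?D (\<gamma> h)) = coset ?D (free_map ?r (\<gamma> h))"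
    by (intro qmap_free_map subspace_diamond2; simp only: vanishes_iff)+
  moreover have "qmap ?D (free_map ?l) (\<Gamma> h) = qmap ?D (free_map ?r) (\<Gamma> h)"
    using \<Gamma>_hom by (simp add: Re_ring_hom_timesR_def timesR_def)
  ultimately have "coset ?D (free_map ?l (\<gamma> h)) = coset ?D (free_map ?r (\<gamma> h))"
    by (simp only: \<Gamma>_eq)
  then have "L t (free_map ?l (\<gamma> h)) = L t (free_map ?r (\<gamma> h))"
    using t by (intro coset_eqD[OF subspace_diamond2 vector_space_mult]) (simp_all only: vanishes_iff)
  then show ?thesis
    by (simp add: lin_ext_free_map vector_spaces case_prod_unfold)
qed

lemma balanced_mult_right:
  assumes t: "balanced (*) t"
  shows "balanced (*) (\<lambda>(m, n). t (m * a, n * b))"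
proof -
  have b: "bilinear sH (*) t" using t by (simp add: balanced_def)
  show ?thesis
    unfolding balanced_def bilinear_def prod.case
    using t
    by (intro conjI allI linear_bilinear_left[OF b] linear_bilinear_right[OF b] linearity)
      (simp add: balanced_def mult.assoc)
qed

lemma \<gamma>_mult:
  assumes t: "balanced (*) t"
  shows "L t (\<gamma> (g * h)) = L (\<lambda>(a, b). L (\<lambda>(a', b'). t (a * a', b * b')) (\<gamma> h)) (\<gamma> g)"
proof -
  let ?D = "diamond2 sR sH \<iota>"
  let ?m = "\<lambda>(a, b). \<lambda>(a', b'). (a * a', b * b')"
  have "qmap2 ?D (free_map2 ?m) (coset ?D (\<gamma> g)) (coset ?D (\<gamma> h)) = coset ?D (free_map2 ?m (\<gamma> g) (\<gamma> h))"
  proof (rule qmap2_free_map2[OF subspace_diamond2 subspace_diamond2 subspace_diamond2];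
      unfold vanishes_iff)
    fix u and p :: "'h \<times> 'h"
    assume u: "balanced (*) u"
    show "balanced (*) (\<lambda>a. u (?m a p))"
      using balanced_mult_right[OF u, of "fst p" "snd p"] by (simp add: case_prod_unfold)
  next
    fix u
    assume u: "balanced (*) u"
    then have b: "bilinear sH (*) u" by (simp add: balanced_def)
    \<comment> \<open>Here \<open>j r\<close> stands to the right of \<open>a\<close>, out of reach
      of the relations of \<open>H \<diamond> H\<close>. Only the sum over
      \<open>\<gamma> g\<close>, through \<open>\<gamma>_timesR\<close>, moves it to the other
      leg.\<close>
    have "L (\<lambda>(a, b). u (a * (j r * m), b * n)) (\<gamma> g) = L (\<lambda>(a, b). u (a * m, b * (i r * n))) (\<gamma> g)"
      for r m n
      using \<gamma>_timesR[OF balanced_mult_right[OF u, of m n], of r g] by (simp add: mult.assoc)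
    then have "balanced (*) (\<lambda>(a', b'). L (\<lambda>(a, b). u (a * a', b * b')) (\<gamma> g))"
      unfolding balanced_def bilinear_def prod.case
      by (intro conjI allI linear_bilinear_left[OF b] linear_bilinear_right[OF b] linearity)
    then show "balanced (*) (\<lambda>p. L (\<lambda>a. u (?m a p)) (\<gamma> g))"
      by (simp add: case_prod_unfold)
  qed
  moreover have "\<Gamma> (g * h) = qmap2 ?D (free_map2 ?m) (\<Gamma> g) (\<Gamma> h)"
    using \<Gamma>_hom by (simp add: Re_ring_hom_timesR_def mult2_def)
  ultimately have "\<Gamma> (g * h) = coset ?D (free_map2 ?m (\<gamma> g) (\<gamma> h))"
    by (simp only: \<Gamma>_eq)
  from \<gamma>_eval[OF this t] show ?thesis
    by (simp add: lin_ext_free_map2 vector_spaces case_prod_unfold)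
qed

lemma \<gamma>_1:
  assumes t: "balanced (*) t"
  shows "L t (\<gamma> 1) = t (1, 1)"
proof -
  have "\<Gamma> 1 = coset (diamond2 sR sH \<iota>) (basis (1, 1))"
    using \<Gamma>_hom by (simp add: Re_ring_hom_timesR_def)
  from \<gamma>_eval[OF this t] show ?thesis by (simp add: lin_ext_basis vector_spaces)
qed

lemma \<gamma>_k:
  assumes t: "balanced (*) t"
  shows "L t (\<gamma> (k r q)) = t (i r, j q)"
proof -
  let ?D = "diamond2 sR sH \<iota>"
  let ?f = "\<lambda>(r, s). (i r, j s)"
  have "bilinear sR (*) (\<lambda>p. u (?f p))" if u: "balanced (*) u" for u
  proof -
    have b: "bilinear sH (*) u" using u by (simp add: balanced_def)
    show ?thesis
      unfolding bilinear_def prod.case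
      by (intro conjI allI linear_bilinear_left[OF b] linear_bilinear_right[OF b] linearity)
  qed
  then have "qmap ?D (free_map ?f) (coset (tensor2 sR) (basis (r, q))) = coset ?D (basis (i r, j q))"
    by (subst qmap_free_map) (simp_all add: subspace_diamond2 subspace_tensor2 vanishes_iff free_map_basis)
  then have "\<Gamma> (k r q) = coset ?D (basis (i r, j q))"
    using \<Gamma>_hom by (simp add: Re_ring_hom_timesR_def k_def quot_def)
  from \<gamma>_eval[OF this t] show ?thesis by (simp add: lin_ext_basis vector_spaces)
qed

lemma \<gamma>_k_mult:
  assumes t: "balanced (*) t"
  shows "L t (\<gamma> (k r q * h)) = L (\<lambda>(m, n). t (i r * m, j q * n)) (\<gamma> h)"
proof -
  have "balanced (*) (\<lambda>(a, b). L (\<lambda>(a', b'). t (a * a', b * b')) (\<gamma> h))"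
  proof -
    have b: "bilinear sH (*) t" using t by (simp add: balanced_def)
    show ?thesis
      unfolding balanced_def bilinear_def prod.case
      using t
      by (intro conjI allI linear_bilinear_left[OF b] linear_bilinear_right[OF b] linearity)
        (simp add: balanced_def mult.assoc)
  qed
  from \<gamma>_k[OF this] show ?thesis by (simp add: \<gamma>_mult[OF t])
qed

text \<open>Elements of \<open>R\<close> pass through \<open>\<Gamma>\<close> on the first leg and
  those of the opposite algebra on the second. The coassociativity arguments rely on this.\<close>

lemma \<gamma>_i: "balanced (*) t \<Longrightarrow> L t (\<gamma> (i r * h)) = L (\<lambda>(m, n). t (i r * m, n)) (\<gamma> h)"
  and \<gamma>_j: "balanced (*) t \<Longrightarrow> L t (\<gamma> (j q * h)) = L (\<lambda>(m, n). t (m, j q * n)) (\<gamma> h)"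
  using \<gamma>_k_mult[of t r 1 h] \<gamma>_k_mult[of t 1 q h] by (simp_all add: k_eq)

lemma \<gamma>_coassoc:
  assumes T: "balanced3 T"
  shows "L (\<lambda>(a, b). L (\<lambda>(p, q). T (p, q, b)) (\<gamma> a)) (\<gamma> h)
    = L (\<lambda>(a, b). L (\<lambda>(p, q). T (a, p, q)) (\<gamma> b)) (\<gamma> h)"
proof -
  let ?D2 = "diamond2 sR sH \<iota>" and ?D3 = "diamond3 sR sH \<iota>"
  let ?l = "lin_ext fscale (\<lambda>(a, b). free_map (\<lambda>(p, q). (p, q, b)) (\<gamma> a)) (\<gamma> h)"
  let ?r = "lin_ext fscale (\<lambda>(a, b). free_map (\<lambda>(p, q). (a, p, q)) (\<gamma> b)) (\<gamma> h)"
  have inner: "balanced (*) (\<lambda>(p, q). t (p, q, b))" "balanced (*) (\<lambda>(p, q). t (a, p, q))"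
    if t: "balanced3 t" for t a b
  proof -
    have b: "trilinear sH (*) t" using t by (simp add: balanced3_def)
    show "balanced (*) (\<lambda>(p, q). t (p, q, b))" "balanced (*) (\<lambda>(p, q). t (a, p, q))"
      unfolding balanced_def bilinear_def prod.case
      using t by (intro conjI allI linear_trilinear[OF b] linearity; simp add: balanced3_def)+
  qed
  have outer: "balanced (*) (\<lambda>(a, b). L (\<lambda>(p, q). t (p, q, b)) (\<gamma> a))"
    "balanced (*) (\<lambda>(a, b). L (\<lambda>(p, q). t (a, p, q)) (\<gamma> b))" if t: "balanced3 t" for t
  proof -
    have b: "trilinear sH (*) t" using t by (simp add: balanced3_def)
    note lin = linear_trilinear[OF b] linear_\<gamma>[OF inner(1)[OF t]] linear_\<gamma>[OF inner(2)[OF t]] linearity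
    \<comment> \<open>This makes the extension of \<open>\<Gamma>\<close> by an outer leg well
      defined: \<open>\<gamma>_j\<close> sends \<open>j r\<close> to the second inner leg, which is
      adjacent to the third leg, and balance of \<open>t\<close> there finishes. The mirror case
      uses \<open>\<gamma>_i\<close> and the first inner leg.\<close>
    have "L (\<lambda>(p, q). t (p, q, n)) (\<gamma> (j r * m)) = L (\<lambda>(p, q). t (p, q, i r * n)) (\<gamma> m)" for r m n
      using t \<gamma>_j[OF inner(1)[OF t]] by (simp add: balanced3_def)
    then show "balanced (*) (\<lambda>(a, b). L (\<lambda>(p, q). t (p, q, b)) (\<gamma> a))"
      unfolding balanced_def bilinear_def prod.case by (intro conjI allI lin)
    have "L (\<lambda>(p, q). t (j r * m, p, q)) (\<gamma> n) = L (\<lambda>(p, q). t (m, p, q)) (\<gamma> (i r * n))" for r m n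
      using t \<gamma>_i[OF inner(2)[OF t]] by (simp add: balanced3_def)
    then show "balanced (*) (\<lambda>(a, b). L (\<lambda>(p, q). t (a, p, q)) (\<gamma> b))"
      unfolding balanced_def bilinear_def prod.case by (intro conjI allI lin)
  qed
  have "map_left ?D3 \<Gamma> (coset ?D2 (\<gamma> h)) = coset ?D3 ?l"
    by (rule map_left_coset[OF subspace_diamond2 subspace_diamond2 subspace_diamond3 \<Gamma>_eq])
      (simp_all only: vanishes_iff inner outer)
  moreover have "map_right ?D3 \<Gamma> (coset ?D2 (\<gamma> h)) = coset ?D3 ?r"
    by (rule map_right_coset[OF subspace_diamond2 subspace_diamond2 subspace_diamond3 \<Gamma>_eq])
      (simp_all only: vanishes_iff inner outer)
  moreover have "map_left ?D3 \<Gamma> (\<Gamma> h) = map_right ?D3 \<Gamma> (\<Gamma> h)"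
    using bialgebra by (simp add: timesR_bialgebra_def)
  ultimately have "coset ?D3 ?l = coset ?D3 ?r" by (simp only: \<Gamma>_eq)
  then have "L T ?l = L T ?r"
    using T by (intro coset_eqD[OF subspace_diamond3 vector_space_mult]) (simp_all only: vanishes_iff)
  then show ?thesis
    by (simp only: lin_ext_lin_ext lin_ext_free_map vector_spaces case_prod_unfold)
qed

text \<open>The integrand is balanced because \<open>C (j r * m) 1 = C m 1 * r\<close>, so the
  counit axiom can be read on the representative \<open>\<gamma> h\<close>.\<close>

lemma \<gamma>_counit_left: "lin_ext sH (\<lambda>(a, b). i (C a 1) * b) (\<gamma> h) = h"
proof -
  have "balanced sH (\<lambda>(a, b). i (C a 1) * b)"
    unfolding balanced_def bilinear_def prod.case
    by (intro conjI allI linearity) (simp add: C_mult C_j i_mult mult.assoc)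
  then have "qlift sH (\<lambda>(a, b). i (C a 1) * b) (coset (diamond2 sR sH \<iota>) (\<gamma> h))
    = lin_ext sH (\<lambda>(a, b). i (C a 1) * b) (\<gamma> h)"
    by (intro qlift_coset subspace_diamond2 vector_spaces)
      (simp only: vanishes_on_diamond2_iff vector_spaces)
  moreover have "qlift sH (\<lambda>(a, b). i (C a 1) * b) (\<Gamma> h) = h"
    using bialgebra by (simp add: timesR_bialgebra_def)
  ultimately show ?thesis by (simp only: \<Gamma>_eq)
qed

lemma \<gamma>_counit_right: "lin_ext sH (\<lambda>(a, b). j (C b 1) * a) (\<gamma> h) = h"
proof -
  have "balanced sH (\<lambda>(a, b). j (C b 1) * a)"
    unfolding balanced_def bilinear_def prod.case
    by (intro conjI allI linearity) (simp add: C_mult C_i j_mult mult.assoc)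
  then have "qlift sH (\<lambda>(a, b). j (C b 1) * a) (coset (diamond2 sR sH \<iota>) (\<gamma> h))
    = lin_ext sH (\<lambda>(a, b). j (C b 1) * a) (\<gamma> h)"
    by (intro qlift_coset subspace_diamond2 vector_spaces)
      (simp only: vanishes_on_diamond2_iff vector_spaces)
  moreover have "qlift sH (\<lambda>(a, b). j (C b 1) * a) (\<Gamma> h) = h"
    using bialgebra by (simp add: timesR_bialgebra_def)
  ultimately show ?thesis by (simp only: \<Gamma>_eq)
qed

text \<open>
  A functional \<open>t\<close> on \<open>H \<otimes> H\<close> evaluates the comultiplication of \<open>h\<close> as \<open>W t\<close> evaluates \<open>\<Gamma> h\<close>, and the
  Casimir property of \<open>e\<close> makes \<open>W t\<close> a functional on \<open>H \<diamond> H\<close>.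
\<close>

definition W where
  "W s t = (\<lambda>(a, b). lin_ext s (\<lambda>(r, q). t (j r * a, i q * b)) e0)"

lemma W_apply: "W s t (a, b) = lin_ext s (\<lambda>(r, q). t (j r * a, i q * b)) e0"
  by (simp add: W_def)

lemma balanced_W:
  assumes s: "vector_space s" and t: "bilinear sH s t"
  shows "balanced s (W s t)"
proof -
  note lin = linear_bilinear_left[OF t] linear_bilinear_right[OF t] linearity
  have "W s t (j x * m, n) = W s t (m, i x * n)" for x m n
  proof -
    have "bilinear sR s (\<lambda>(r, q). t (j r * m, i q * n))"
      unfolding bilinear_def prod.case by (intro conjI allI lin)
    \<comment> \<open>Since \<open>j\<close> reverses products, \<open>j (x * r) = j r * j x\<close>
      places \<open>x\<close> next to \<open>m\<close>, while \<open>i (q * x) = i q * i x\<close>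
      places it next to \<open>n\<close>.\<close>
    from casimir[OF s this, of x] show ?thesis
      by (simp add: W_def i_mult j_mult mult.assoc)
  qed
  then show ?thesis
    unfolding balanced_def bilinear_def W_apply by (intro conjI allI lin) auto
qed

definition D where
  "D h = free_map2 (\<lambda>(r, q) (a, b). (j r * a, i q * b)) e0 (\<gamma> h)"

lemma D_eval:
  assumes "vector_space s"
  shows "lin_ext s t (D h) = lin_ext s (W s t) (\<gamma> h)"
  unfolding D_def lin_ext_free_map2[OF assms] W_def
  using lin_ext_swap_pairs[OF assms, of "\<lambda>r q a b. t (j r * a, i q * b)" "\<gamma> h" e0]
  by (simp add: case_prod_unfold)

abbreviation \<Delta> where
  "\<Delta> h \<equiv> qmap2 (tensor2 sH) (free_map2 (\<lambda>(r, q) (a, b). (j r * a, i q * b))) e (\<Gamma> h)"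

text \<open>The formula for the comultiplication is well defined: independence of the representative
  of \<open>e\<close> is bilinearity, independence of that of \<open>\<Gamma> h\<close> is
  \<open>balanced_W\<close>.\<close>

lemma \<Delta>_eq: "\<Delta> h = coset (tensor2 sH) (D h)"
proof -
  let ?f = "\<lambda>(r, q) (a, b). (j r * a, i q * b)"
  have "qmap2 (tensor2 sH) (free_map2 ?f) (coset (tensor2 sR) e0) (coset (diamond2 sR sH \<iota>) (\<gamma> h))
    = coset (tensor2 sH) (free_map2 ?f e0 (\<gamma> h))"
  proof (rule qmap2_free_map2[OF subspace_tensor2 subspace_diamond2 subspace_tensor2];
      unfold vanishes_iff)
    fix t and p :: "'h \<times> 'h"
    assume t: "bilinear sH (*) t"
    obtain a b where p: "p = (a, b)" by (cases p)
    show "bilinear sR (*) (\<lambda>x. t (?f x p))"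
      unfolding bilinear_def p prod.case
      by (intro conjI allI linear_bilinear_left[OF t] linear_bilinear_right[OF t] linearity)
  next
    fix t
    assume t: "bilinear sH (*) t"
    show "balanced (*) (\<lambda>p. L (\<lambda>x. t (?f x p)) e0)"
      using balanced_W[OF vector_space_mult t] by (simp add: W_def case_prod_unfold)
  qed
  then show ?thesis by (simp only: e_eq[symmetric] \<Gamma>_eq[symmetric] D_def)
qed

lemma linear_D:
  assumes t: "bilinear sH (*) t" and F: "Vector_Spaces.linear s sH F"
  shows "Vector_Spaces.linear s (*) (\<lambda>x. L t (D (F x)))"
  unfolding D_eval[OF vector_space_mult]
  by (rule linear_\<gamma>[OF balanced_W[OF vector_space_mult t] F])

lemma qlift_\<Delta>:
  assumes "vector_space s" "bilinear sH s t"
  shows "qlift s t (\<Delta> h) = lin_ext s (W s t) (\<gamma> h)"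
  unfolding \<Delta>_eq D_eval[OF assms(1), symmetric]
  using assms by (intro qlift_coset subspace_tensor2) (simp_all only: vanishes_on_tensor2_iff)

section \<open>The counit axioms\<close>

abbreviation \<epsilon> where "\<epsilon> h \<equiv> \<phi> (C h 1)"

text \<open>As \<open>\<epsilon> (j r * a) = \<phi> (C a 1 * r)\<close>, \<open>frob1\<close>
  contracts \<open>e\<close> to \<open>i (C a 1)\<close> and leaves the integrand of
  \<open>\<gamma>_counit_left\<close>. The mirror lemma uses
  \<open>\<epsilon> (i q * b) = \<phi> (q * C b 1)\<close> and \<open>frob2\<close>.\<close>

lemma W_counit_left: "lin_ext sH (W sH (\<lambda>(a, b). sH (\<epsilon> a) b)) (\<gamma> h) = h"
proof -
  have "W sH (\<lambda>(a, b). sH (\<epsilon> a) b) (a, b) = i (C a 1) * b" for a b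
  proof -
    have "Vector_Spaces.linear sR sH (\<lambda>x. i x * b)" by (intro linearity)
    from linear_lin_ext_apply[OF this, of "\<lambda>(r, q). sR (\<phi> (C a 1 * r)) q" e0]
    have "i (C a 1) * b = lin_ext sH (\<lambda>(r, q). i (sR (\<phi> (C a 1 * r)) q) * b) e0"
      by (simp only: frob1) (simp add: case_prod_unfold)
    also have "\<dots> = W sH (\<lambda>(a, b). sH (\<epsilon> a) b) (a, b)"
      using i_linear by (simp add: W_apply C_mult C_j Vector_Spaces.linear_iff H.scale_mult_left)
    finally show ?thesis by simp
  qed
  then have "W sH (\<lambda>(a, b). sH (\<epsilon> a) b) = (\<lambda>(a, b). i (C a 1) * b)" by auto
  then show ?thesis by (simp only: \<gamma>_counit_left)
qed

lemma W_counit_right: "lin_ext sH (W sH (\<lambda>(a, b). sH (\<epsilon> b) a)) (\<gamma> h) = h"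
proof -
  have "W sH (\<lambda>(a, b). sH (\<epsilon> b) a) (a, b) = j (C b 1) * a" for a b
  proof -
    have "Vector_Spaces.linear sR sH (\<lambda>x. j x * a)" by (intro linearity)
    from linear_lin_ext_apply[OF this, of "\<lambda>(r, q). sR (\<phi> (q * C b 1)) r" e0]
    have "j (C b 1) * a = lin_ext sH (\<lambda>(r, q). j (sR (\<phi> (q * C b 1)) r) * a) e0"
      by (simp only: frob2) (simp add: case_prod_unfold)
    also have "\<dots> = W sH (\<lambda>(a, b). sH (\<epsilon> b) a) (a, b)"
      using j_linear by (simp add: W_apply C_mult C_i Vector_Spaces.linear_iff H.scale_mult_left)
    finally show ?thesis by simp
  qed
  then have "W sH (\<lambda>(a, b). sH (\<epsilon> b) a) = (\<lambda>(a, b). j (C b 1) * a)" by auto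
  then show ?thesis by (simp only: \<gamma>_counit_right)
qed

lemma qlift_counit:
  "qlift sH (\<lambda>(a, b). sH (\<epsilon> a) b) (\<Delta> h) = h" "qlift sH (\<lambda>(a, b). sH (\<epsilon> b) a) (\<Delta> h) = h"
proof -
  have "bilinear sH sH (\<lambda>(a, b). sH (\<epsilon> a) b)" "bilinear sH sH (\<lambda>(a, b). sH (\<epsilon> b) a)"
    unfolding bilinear_def prod.case by (intro conjI allI linearity)+
  then show "qlift sH (\<lambda>(a, b). sH (\<epsilon> a) b) (\<Delta> h) = h" "qlift sH (\<lambda>(a, b). sH (\<epsilon> b) a) (\<Delta> h) = h"
    by (simp_all only: qlift_\<Delta>[OF H.vector_space_axioms] W_counit_left W_counit_right)
qed

text \<open>The two counits become \<open>\<phi> (C f (C a 1 * r))\<close> and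
  \<open>\<phi> (q * C b (C h 1))\<close>; \<open>frob2\<close> substitutes
  \<open>C b (C h 1)\<close> for \<open>r\<close> in the first.\<close>

lemma W_\<epsilon>_left: "W (*) (\<lambda>(a, b). \<epsilon> (f * a) * \<epsilon> (b * h)) (a, b) = \<phi> (C f (C a 1 * C b (C h 1)))"
proof -
  have "Vector_Spaces.linear sR (*) (\<lambda>x. \<phi> (C f (C a 1 * x)))" by (intro linearity)
  from linear_lin_ext_apply[OF this, of "\<lambda>(r, q). sR (\<phi> (q * C b (C h 1))) r" e0]
  have "\<phi> (C f (C a 1 * C b (C h 1)))
    = L (\<lambda>(r, q). \<phi> (C f (C a 1 * sR (\<phi> (q * C b (C h 1))) r))) e0"
    by (simp only: frob2) (simp add: case_prod_unfold)
  also have "\<dots> = W (*) (\<lambda>(a, b). \<epsilon> (f * a) * \<epsilon> (b * h)) (a, b)"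
    using \<phi>_linear C_linear[of f]
    by (simp add: W_apply C_mult C_i C_j Vector_Spaces.linear_iff R.scale_mult_right mult.commute)
  finally show ?thesis by simp
qed

lemma W_\<epsilon>_right: "W (*) (\<lambda>(a, b). \<epsilon> (f * b) * \<epsilon> (a * h)) (a, b) = \<phi> (C f (C a (C h 1) * C b 1))"
proof -
  have "Vector_Spaces.linear sR (*) (\<lambda>x. \<phi> (C f (x * C b 1)))" by (intro linearity)
  from linear_lin_ext_apply[OF this, of "\<lambda>(r, q). sR (\<phi> (C a (C h 1) * r)) q" e0]
  have "\<phi> (C f (C a (C h 1) * C b 1))
    = L (\<lambda>(r, q). \<phi> (C f (sR (\<phi> (C a (C h 1) * r)) q * C b 1))) e0"
    by (simp only: frob1) (simp add: case_prod_unfold)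
  also have "\<dots> = W (*) (\<lambda>(a, b). \<epsilon> (f * b) * \<epsilon> (a * h)) (a, b)"
    using \<phi>_linear C_linear[of f]
    by (simp add: W_apply C_mult C_i C_j Vector_Spaces.linear_iff R.scale_mult_left mult.commute)
  finally show ?thesis by simp
qed

text \<open>The contracted products are again values of \<open>C\<close>:
  \<open>C a 1 * C b y = C (i (C a 1) * b) y\<close> and
  \<open>C a y * C b 1 = C (j (C b 1) * a) y\<close>. Summing over \<open>\<gamma> g\<close> then
  yields \<open>C g y\<close> by the two counit identities for \<open>\<Gamma>\<close>.\<close>

lemma \<epsilon>_mult:
  "\<epsilon> (f * g * h) = qlift (*) (\<lambda>(a, b). \<epsilon> (f * a) * \<epsilon> (b * h)) (\<Delta> g)"
  "\<epsilon> (f * g * h) = qlift (*) (\<lambda>(a, b). \<epsilon> (f * b) * \<epsilon> (a * h)) (\<Delta> g)"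
proof -
  have bil: "bilinear sH (*) (\<lambda>(a, b). \<epsilon> (f * a) * \<epsilon> (b * h))"
    "bilinear sH (*) (\<lambda>(a, b). \<epsilon> (f * b) * \<epsilon> (a * h))"
    unfolding bilinear_def prod.case by (intro conjI allI linearity)+
  have W: "W (*) (\<lambda>(a, b). \<epsilon> (f * a) * \<epsilon> (b * h)) = (\<lambda>(a, b). \<phi> (C f (C (i (C a 1) * b) (C h 1))))"
    "W (*) (\<lambda>(a, b). \<epsilon> (f * b) * \<epsilon> (a * h)) = (\<lambda>(a, b). \<phi> (C f (C (j (C b 1) * a) (C h 1))))"
    by (simp_all only: fun_eq_iff split_paired_All W_\<epsilon>_left W_\<epsilon>_right prod.case)
      (simp_all add: C_mult C_i C_j)
  have lin: "Vector_Spaces.linear sH (*) (\<lambda>x. \<phi> (C f (C x (C h 1))))" by (intro linearity)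
  have "\<epsilon> (f * g * h) = \<phi> (C f (C g (C h 1)))" by (simp add: C_mult)
  then show "\<epsilon> (f * g * h) = qlift (*) (\<lambda>(a, b). \<epsilon> (f * a) * \<epsilon> (b * h)) (\<Delta> g)"
    "\<epsilon> (f * g * h) = qlift (*) (\<lambda>(a, b). \<epsilon> (f * b) * \<epsilon> (a * h)) (\<Delta> g)"
    using linear_lin_ext_apply[OF lin, of "\<lambda>(a, b). i (C a 1) * b" "\<gamma> g"]
      linear_lin_ext_apply[OF lin, of "\<lambda>(a, b). j (C b 1) * a" "\<gamma> g"]
    unfolding qlift_\<Delta>[OF vector_space_mult bil(1)] qlift_\<Delta>[OF vector_space_mult bil(2)] W
      \<gamma>_counit_left \<gamma>_counit_right
    by (simp_all only: case_prod_unfold)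
qed

section \<open>Linearity and multiplicativity of the comultiplication\<close>

lemma \<Delta>_linear: "linear_into_quot sH (tensor2 sH) \<Delta>"
  by (rule linear_into_quotI[OF subspace_tensor2 \<Delta>_eq])
    (use linear_D[OF _ linear_ident[OF H.vector_space_axioms]] in \<open>simp add: vanishes_iff\<close>)

text \<open>
  The middle factor \<open>f\<^sub>1f\<^sub>2\<close> that remains after moving the legs of the second copy \<open>f\<close> of \<open>e\<close>
  through \<open>\<Gamma> g\<close> is \<open>1\<close> by idempotency.
\<close>

lemma D_mult:
  assumes t: "bilinear sH (*) t"
  shows "L t (D (g * h)) = L (\<lambda>(a, b). L (\<lambda>(a', b'). t (a * a', b * b')) (D h)) (D g)"
proof -
  have Wt: "balanced (*) (W (*) t)" by (rule balanced_W[OF vector_space_mult t])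
  then have WtB: "bilinear sH (*) (W (*) t)" by (simp add: balanced_def)
  \<comment> \<open>\<open>t'\<close> is the pairing with the factor \<open>D h\<close> held fixed.
    The copy of \<open>e\<close> from \<open>D g\<close> acts from the far left and is absorbed into
    \<open>W\<close>; the copy from \<open>D h\<close> stays between the two factors.\<close>
  define t' where "t' = (\<lambda>(a, b). L (\<lambda>(a', b'). t (a * a', b * b')) (D h))"
  have "W (*) t' (a, b) = L (\<lambda>(a', b'). L (\<lambda>(r, q). W (*) t (a * (j r * a'), b * (i q * b'))) e0) (\<gamma> h)"
    for a b
  proof -
    have "W (*) t' (a, b) = L (\<lambda>(r', q'). L (\<lambda>(a', b'). L (\<lambda>(r, q).
        t (j r' * (a * (j r * a')), i q' * (b * (i q * b')))) e0) (\<gamma> h)) e0"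
      by (simp add: W_def t'_def D_eval[OF vector_space_mult] mult.assoc)
    also have "\<dots> = L (\<lambda>(a', b'). L (\<lambda>(r', q'). L (\<lambda>(r, q).
        t (j r' * (a * (j r * a')), i q' * (b * (i q * b')))) e0) e0) (\<gamma> h)"
      by (rule swap)
    also have "\<dots> = L (\<lambda>(a', b'). L (\<lambda>(r, q). L (\<lambda>(r', q').
        t (j r' * (a * (j r * a')), i q' * (b * (i q * b')))) e0) e0) (\<gamma> h)"
      by (subst swap[of _ e0 e0]) (rule refl)
    finally show ?thesis by (simp only: W_apply)
  qed
  then have Wt': "W (*) t' = (\<lambda>(a, b). L (\<lambda>(a', b'). L (\<lambda>(r, q).
      W (*) t (a * (j r * a'), b * (i q * b'))) e0) (\<gamma> h))"
    by (simp add: fun_eq_iff)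
  have one: "L (\<lambda>(r, q). W (*) t (x, b * (i r * (i q * b')))) e0 = W (*) t (x, b * b')" for x b b'
  proof -
    have "Vector_Spaces.linear sR (*) (\<lambda>y. W (*) t (x, b * (i y * b')))"
      by (intro linear_bilinear_right[OF WtB] linearity)
    from linear_lin_ext_apply[OF this, of "\<lambda>(r, q). r * q" e0] show ?thesis
      by (simp only: idem) (simp add: case_prod_unfold i_mult mult.assoc)
  qed
  have "L t' (D g) = L (\<lambda>(a, b). L (\<lambda>(a', b'). L (\<lambda>(r, q).
      W (*) t (a * (j r * a'), b * (i q * b'))) e0) (\<gamma> h)) (\<gamma> g)"
    by (simp only: D_eval[OF vector_space_mult] Wt')
  also have "\<dots> = L (\<lambda>(a', b'). L (\<lambda>(a, b). L (\<lambda>(r, q).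
      W (*) t (a * (j r * a'), b * (i q * b'))) e0) (\<gamma> g)) (\<gamma> h)"
    by (rule swap)
  also have "\<dots> = L (\<lambda>(a', b'). L (\<lambda>(r, q). L (\<lambda>(a, b).
      W (*) t (a * (j r * a'), b * (i q * b'))) (\<gamma> g)) e0) (\<gamma> h)"
    by (subst swap[of _ e0 "\<gamma> g"]) (rule refl)
  also have "\<dots> = L (\<lambda>(a', b'). L (\<lambda>(r, q). L (\<lambda>(a, b).
      W (*) t (a * a', b * (i r * (i q * b')))) (\<gamma> g)) e0) (\<gamma> h)"
  proof -
    have "L (\<lambda>(a, b). W (*) t (a * (j r * a'), b * (i q * b'))) (\<gamma> g)
      = L (\<lambda>(a, b). W (*) t (a * a', b * (i r * (i q * b')))) (\<gamma> g)" for a' b' r q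
      using \<gamma>_timesR[OF balanced_mult_right[OF Wt, of a' "i q * b'"], of r g]
      by (simp add: mult.assoc)
    then show ?thesis by (simp only:)
  qed
  also have "\<dots> = L (\<lambda>(a', b'). L (\<lambda>(a, b). L (\<lambda>(r, q).
      W (*) t (a * a', b * (i r * (i q * b')))) e0) (\<gamma> g)) (\<gamma> h)"
    by (subst swap[of _ "\<gamma> g" e0]) (rule refl)
  also have "\<dots> = L (\<lambda>(a, b). L (\<lambda>(a', b'). W (*) t (a * a', b * b')) (\<gamma> h)) (\<gamma> g)"
    by (simp only: one) (rule swap)
  also have "\<dots> = L t (D (g * h))"
    by (simp only: D_eval[OF vector_space_mult] \<gamma>_mult[OF Wt])
  finally show ?thesis by (simp add: t'_def)
qed

lemma \<Delta>_mult: "\<Delta> (g * h) = qmap2 (tensor2 sH) mult2 (\<Delta> g) (\<Delta> h)"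
proof -
  let ?m = "\<lambda>(a, b). \<lambda>(a', b'). (a * a', b * b')"
  have "qmap2 (tensor2 sH) (free_map2 ?m) (coset (tensor2 sH) (D g)) (coset (tensor2 sH) (D h))
    = coset (tensor2 sH) (free_map2 ?m (D g) (D h))"
  proof (rule qmap2_free_map2[OF subspace_tensor2 subspace_tensor2 subspace_tensor2];
      unfold vanishes_iff)
    fix t and p :: "'h \<times> 'h"
    assume t: "bilinear sH (*) t"
    obtain a b where p: "p = (a, b)" by (cases p)
    show "bilinear sH (*) (\<lambda>x. t (?m x p))"
      unfolding bilinear_def p prod.case
      by (intro conjI allI linear_bilinear_left[OF t] linear_bilinear_right[OF t] linearity)
  next
    fix t
    assume t: "bilinear sH (*) t"
    have "bilinear sH (*) (\<lambda>(a', b'). L (\<lambda>(a, b). t (a * a', b * b')) (D g))"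
      unfolding bilinear_def prod.case
      by (intro conjI allI linear_bilinear_left[OF t] linear_bilinear_right[OF t] linearity)
    then show "bilinear sH (*) (\<lambda>p. L (\<lambda>x. t (?m x p)) (D g))"
      by (simp add: case_prod_unfold)
  qed
  also have "\<dots> = coset (tensor2 sH) (D (g * h))"
    by (rule coset_eqI[OF subspace_tensor2])
      (simp add: vanishes_iff D_mult lin_ext_free_map2 vector_spaces case_prod_unfold)
  finally show ?thesis by (simp only: \<Delta>_eq mult2_def)
qed

section \<open>Coassociativity\<close>

definition D_left where
  "D_left h = lin_ext fscale (\<lambda>(a, b). free_map (\<lambda>(p, q). (p, q, b)) (D a)) (D h)"

definition D_right where
  "D_right h = lin_ext fscale (\<lambda>(a, b). free_map (\<lambda>(p, q). (a, p, q)) (D b)) (D h)"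

lemma bilinear_slices:
  assumes t: "trilinear sH (*) t"
  shows "bilinear sH (*) (\<lambda>(p, q). t (p, q, b))" "bilinear sH (*) (\<lambda>(p, q). t (a, p, q))"
  unfolding bilinear_def prod.case by (intro conjI allI linear_trilinear[OF t] linearity)+

lemma bilinear_D_slices:
  assumes t: "trilinear sH (*) t"
  shows "bilinear sH (*) (\<lambda>(a, b). L (\<lambda>(p, q). t (p, q, b)) (D a))"
    and "bilinear sH (*) (\<lambda>(a, b). L (\<lambda>(p, q). t (a, p, q)) (D b))"
  unfolding bilinear_def prod.case
  by (intro conjI allI linear_D[OF bilinear_slices(1)[OF t]] linear_D[OF bilinear_slices(2)[OF t]]
      linear_trilinear[OF t] linearity)+

lemma map_left_\<Delta>: "map_left (tensor3 sH) \<Delta> (\<Delta> h) = coset (tensor3 sH) (D_left h)"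
proof -
  have "map_left (tensor3 sH) \<Delta> (coset (tensor2 sH) (D h)) = coset (tensor3 sH) (D_left h)"
    unfolding D_left_def
    by (rule map_left_coset[OF subspace_tensor2 subspace_tensor2 subspace_tensor3 \<Delta>_eq])
      (simp_all only: vanishes_iff bilinear_slices bilinear_D_slices)
  then show ?thesis by (simp only: \<Delta>_eq)
qed

lemma map_right_\<Delta>: "map_right (tensor3 sH) \<Delta> (\<Delta> h) = coset (tensor3 sH) (D_right h)"
proof -
  have "map_right (tensor3 sH) \<Delta> (coset (tensor2 sH) (D h)) = coset (tensor3 sH) (D_right h)"
    unfolding D_right_def
    by (rule map_right_coset[OF subspace_tensor2 subspace_tensor2 subspace_tensor3 \<Delta>_eq])
      (simp_all only: vanishes_iff bilinear_slices bilinear_D_slices)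
  then show ?thesis by (simp only: \<Delta>_eq)
qed

lemma L_D_left: "L t (D_left h) = L (\<lambda>(a, b). L (\<lambda>(p, q). t (p, q, b)) (D a)) (D h)"
  and L_D_right: "L t (D_right h) = L (\<lambda>(a, b). L (\<lambda>(p, q). t (a, p, q)) (D b)) (D h)"
  by (simp_all only: D_left_def D_right_def lin_ext_lin_ext lin_ext_free_map vector_spaces
      case_prod_unfold)

text \<open>Both iterated comultiplications evaluate \<open>t\<close> as the single form
  \<open>?u\<close> evaluates the iterates of \<open>\<Gamma>\<close>. In \<open>?u\<close> one copy
  \<open>(x', y')\<close> of \<open>e\<close> joins legs one and two, another \<open>(x, y)\<close>
  joins legs two and three. The Casimir identity at each junction makes \<open>?u\<close> balanced,
  so \<open>\<gamma>_coassoc\<close> applies.\<close>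

lemma D_coassoc:
  assumes t: "trilinear sH (*) t"
  shows "L t (D_left h) = L t (D_right h)"
proof -
  let ?u = "\<lambda>(a, p, q). L (\<lambda>(x, y). L (\<lambda>(x', y'). t (j x' * a, i y' * (j x * p), i y * q)) e0) e0"
  note lin = linear_trilinear[OF t] linearity
  have bal: "balanced (*) (W (*) (\<lambda>(p, q). t (p, q, b)))" "balanced (*) (W (*) (\<lambda>(p, q). t (a, p, q)))"
    for a b
    using balanced_W[OF vector_space_mult] bilinear_slices[OF t] by auto
  have u1: "?u (j z * a, p, q) = ?u (a, i z * p, q)" for z a p q
  proof -
    have "L (\<lambda>(x', y'). t (j x' * (j z * a), i y' * (j x * p), i y * q)) e0
      = L (\<lambda>(x', y'). t (j x' * a, i y' * (j x * (i z * p)), i y * q)) e0" for x y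
    proof -
      have "bilinear sR (*) (\<lambda>(x', y'). t (j x' * a, i y' * (j x * p), i y * q))"
        unfolding bilinear_def prod.case by (intro conjI allI lin)
      from casimir[OF vector_space_mult this, of z] show ?thesis
        by (simp add: i_mult j_mult mult.assoc i_j_assoc)
    qed
    then show ?thesis by (simp only: prod.case)
  qed
  have u2: "?u (a, j z * p, q) = ?u (a, p, i z * q)" for z a p q
  proof -
    have "bilinear sR (*) (\<lambda>(x, y). L (\<lambda>(x', y'). t (j x' * a, i y' * (j x * p), i y * q)) e0)"
      unfolding bilinear_def prod.case by (intro conjI allI lin)
    from casimir[OF vector_space_mult this, of z] show ?thesis
      by (simp add: i_mult j_mult mult.assoc)
  qed
  have "trilinear sH (*) ?u"
    unfolding trilinear_def prod.case by (intro conjI allI lin)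
  with u1 u2 have u: "balanced3 ?u" by (simp only: balanced3_def) blast
  have "L t (D_left h) = L (\<lambda>(a, b). L (\<lambda>(x, y). L (\<lambda>(p, q). L (\<lambda>(x', y').
      t (j x' * p, i y' * (j x * q), i y * b)) e0) (\<gamma> a)) e0) (\<gamma> h)"
    \<comment> \<open>The outer \<open>j x\<close> acts on \<open>a\<close> before
      \<open>\<Gamma>\<close> is applied; \<open>\<gamma>_j\<close> carries it to the second leg of
      \<open>\<Gamma> a\<close>, the middle leg of the triple.\<close>
    unfolding L_D_left D_eval[OF vector_space_mult]
    by (simp add: W_def[of _ "\<lambda>(a, b). L (W (*) (u a b)) (\<gamma> a)" for u] \<gamma>_j[OF bal(1)] W_apply)
  also have "\<dots> = L (\<lambda>(a, b). L (\<lambda>(p, q). ?u (p, q, b)) (\<gamma> a)) (\<gamma> h)"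
    unfolding prod.case by (subst swap) (rule refl)
  also have "\<dots> = L (\<lambda>(a, b). L (\<lambda>(p, q). ?u (a, p, q)) (\<gamma> b)) (\<gamma> h)"
    by (rule \<gamma>_coassoc[OF u])
  also have "\<dots> = L (\<lambda>(a, b). L (\<lambda>(p, q). L (\<lambda>(x, y). L (\<lambda>(x', y').
      t (j x * a, j x' * (i y * p), i y' * q)) e0) e0) (\<gamma> b)) (\<gamma> h)"
    \<comment> \<open>The two copies of \<open>e\<close> exchange names, and the factors on the
      middle leg change order because \<open>i\<close> and \<open>j\<close> commute.\<close>
    unfolding prod.case by (subst swap[of _ e0 e0]) (simp only: i_j_assoc)
  also have "\<dots> = L (\<lambda>(a, b). L (\<lambda>(x, y). L (\<lambda>(p, q). L (\<lambda>(x', y').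
      t (j x * a, j x' * (i y * p), i y' * q)) e0) (\<gamma> b)) e0) (\<gamma> h)"
    by (subst swap[of _ "\<gamma> b" e0 for b]) (rule refl)
  also have "\<dots> = L t (D_right h)"
    unfolding L_D_right D_eval[OF vector_space_mult]
    by (simp add: W_def[of _ "\<lambda>(a, b). L (W (*) (u a b)) (\<gamma> b)" for u] \<gamma>_i[OF bal(2)] W_apply)
  finally show ?thesis .
qed

lemma \<Delta>_coassoc: "map_left (tensor3 sH) \<Delta> (\<Delta> h) = map_right (tensor3 sH) \<Delta> (\<Delta> h)"
  unfolding map_left_\<Delta> map_right_\<Delta>
  by (rule coset_eqI[OF subspace_tensor3]) (simp only: vanishes_iff D_coassoc)

lemma coalgebra: "coalgebra sH \<Delta> \<epsilon>"
proof -
  have "Vector_Spaces.linear sH (*) \<epsilon>" by (intro linearity)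
  then show ?thesis
    by (simp only: coalgebra_def \<Delta>_linear \<Delta>_coassoc qlift_counit simp_thms)
qed

section \<open>The unit axioms\<close>

lemma L_D_1:
  assumes t: "bilinear sH (*) t"
  shows "L t (D 1) = L (\<lambda>(r, q). t (j r, i q)) e0"
  using \<gamma>_1[OF balanced_W[OF vector_space_mult t]]
  by (simp add: D_eval[OF vector_space_mult] W_apply)

text \<open>Applying the comultiplication to the first leg \<open>j r\<close> of
  \<open>\<Delta> 1\<close> uses that \<open>\<Gamma> (j r)\<close> is the class of
  \<open>1 \<otimes> j r\<close>, so \<open>j r\<close> ends up in the middle, behind
  \<open>i q'\<close>.\<close>

lemma L_D_left_1:
  assumes t: "trilinear sH (*) t"
  shows "L t (D_left 1) = L (\<lambda>(r, q). L (\<lambda>(r', q'). t (j r', i q' * j r, i q)) e0) e0"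
proof -
  have bal: "balanced (*) (W (*) (\<lambda>(p, q). t (p, q, b)))" for b
    by (rule balanced_W[OF vector_space_mult bilinear_slices(1)[OF t]])
  have "L (\<lambda>(p, q). t (p, q, b)) (D (j r)) = L (\<lambda>(r', q'). t (j r', i q' * j r, b)) e0" for r b
    using \<gamma>_k[OF bal, of b 1 r] by (simp add: D_eval[OF vector_space_mult] W_apply k_eq)
  then show ?thesis
    by (simp add: L_D_left L_D_1[OF bilinear_D_slices(1)[OF t]])
qed

lemma mult3_coset:
  "qmap2 (tensor3 sH) mult3 (coset (tensor3 sH) x) (coset (tensor3 sH) y)
    = coset (tensor3 sH) (mult3 x y)"
  unfolding mult3_def
proof (rule qmap2_free_map2[OF subspace_tensor3 subspace_tensor3 subspace_tensor3];
    unfold vanishes_iff)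
  fix t and p :: "'h \<times> 'h \<times> 'h"
  assume t: "trilinear sH (*) t"
  obtain a b c where p: "p = (a, b, c)" by (cases p)
  show "trilinear sH (*) (\<lambda>x. t ((case x of (a, b, c) \<Rightarrow> \<lambda>(a', b', c'). (a * a', b * b', c * c')) p))"
    unfolding trilinear_def p prod.case by (intro conjI allI linear_trilinear[OF t] linearity)
next
  fix t
  assume t: "trilinear sH (*) t"
  have "trilinear sH (*) (\<lambda>(a', b', c'). L (\<lambda>(a, b, c). t (a * a', b * b', c * c')) x)"
    unfolding trilinear_def prod.case by (intro conjI allI linear_trilinear[OF t] linearity)
  then show "trilinear sH (*) (\<lambda>p. L (\<lambda>x. t ((case x of (a, b, c) \<Rightarrow>
      \<lambda>(a', b', c'). (a * a', b * b', c * c')) p)) x)"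
    by (simp add: case_prod_unfold)
qed

lemma unit_legs:
  "qmap (tensor3 sH) (free_map (\<lambda>(a, b). (a, b, 1))) (\<Delta> 1)
    = coset (tensor3 sH) (free_map (\<lambda>(a, b). (a, b, 1)) (D 1))"
  "qmap (tensor3 sH) (free_map (\<lambda>(a, b). (1, a, b))) (\<Delta> 1)
    = coset (tensor3 sH) (free_map (\<lambda>(a, b). (1, a, b)) (D 1))"
proof -
  have "bilinear sH (*) (\<lambda>p. t (case p of (a, b) \<Rightarrow> (a, b, 1)))"
    "bilinear sH (*) (\<lambda>p. t (case p of (a, b) \<Rightarrow> (1, a, b)))" if "trilinear sH (*) t" for t
    using bilinear_slices[OF that, of 1] by (simp_all add: case_prod_unfold)
  then show "qmap (tensor3 sH) (free_map (\<lambda>(a, b). (a, b, 1))) (\<Delta> 1)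
      = coset (tensor3 sH) (free_map (\<lambda>(a, b). (a, b, 1)) (D 1))"
    "qmap (tensor3 sH) (free_map (\<lambda>(a, b). (1, a, b))) (\<Delta> 1)
      = coset (tensor3 sH) (free_map (\<lambda>(a, b). (1, a, b)) (D 1))"
    unfolding \<Delta>_eq
    by (intro qmap_free_map subspace_tensor2 subspace_tensor3; simp only: vanishes_iff)+
qed

text \<open>One order of multiplication gives the middle leg \<open>i q' * j r\<close>, exactly as
  in \<open>L_D_left_1\<close> up to renaming the two copies of \<open>e\<close>. The other gives
  \<open>j r * i q'\<close>, which agrees because \<open>i\<close> and \<open>j\<close>
  commute.\<close>

lemma \<Delta>_unit:
  "map_left (tensor3 sH) \<Delta> (\<Delta> 1) = qmap2 (tensor3 sH) mult3
    (qmap (tensor3 sH) (free_map (\<lambda>(a, b). (a, b, 1))) (\<Delta> 1))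
    (qmap (tensor3 sH) (free_map (\<lambda>(a, b). (1, a, b))) (\<Delta> 1))" (is "?one = ?lr")
  "map_left (tensor3 sH) \<Delta> (\<Delta> 1) = qmap2 (tensor3 sH) mult3
    (qmap (tensor3 sH) (free_map (\<lambda>(a, b). (1, a, b))) (\<Delta> 1))
    (qmap (tensor3 sH) (free_map (\<lambda>(a, b). (a, b, 1))) (\<Delta> 1))" (is "?one = ?rl")
proof -
  let ?l = "free_map (\<lambda>(a, b). (a, b, 1)) (D 1)" and ?r = "free_map (\<lambda>(a, b). (1, a, b)) (D 1)"
  have "L t (D_left 1) = L t (mult3 ?l ?r)" "L t (D_left 1) = L t (mult3 ?r ?l)"
    if t: "trilinear sH (*) t" for t
  proof -
    note lin = linear_trilinear[OF t] linearity
    have "L t (mult3 ?l ?r) = L (\<lambda>(a, b). L (\<lambda>(a', b'). t (a, b * a', b')) (D 1)) (D 1)"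
      by (simp add: mult3_def lin_ext_free_map2 lin_ext_free_map vector_spaces case_prod_unfold)
    also have "\<dots> = L (\<lambda>(r, q). L (\<lambda>(a', b'). t (j r, i q * a', b')) (D 1)) e0"
      by (subst L_D_1, unfold bilinear_def prod.case, intro conjI allI lin) (rule refl)
    also have "\<dots> = L (\<lambda>(r, q). L (\<lambda>(r', q'). t (j r, i q * j r', i q')) e0) e0"
      by (subst L_D_1, unfold bilinear_def prod.case, intro conjI allI lin) (rule refl)
    also have "\<dots> = L (\<lambda>(r', q'). L (\<lambda>(r, q). t (j r, i q * j r', i q')) e0) e0"
      by (rule swap)
    finally show "L t (D_left 1) = L t (mult3 ?l ?r)" by (simp only: L_D_left_1[OF t])
    have "L t (mult3 ?r ?l) = L (\<lambda>(a', b'). L (\<lambda>(a, b). t (a, a' * b, b')) (D 1)) (D 1)"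
      by (simp add: mult3_def lin_ext_free_map2 lin_ext_free_map vector_spaces case_prod_unfold)
    also have "\<dots> = L (\<lambda>(r, q). L (\<lambda>(a, b). t (a, j r * b, i q)) (D 1)) e0"
      by (subst L_D_1, unfold bilinear_def prod.case, intro conjI allI lin) (rule refl)
    also have "\<dots> = L (\<lambda>(r, q). L (\<lambda>(r', q'). t (j r', j r * i q', i q)) e0) e0"
      by (subst L_D_1, unfold bilinear_def prod.case, intro conjI allI lin) (rule refl)
    finally show "L t (D_left 1) = L t (mult3 ?r ?l)" by (simp only: L_D_left_1[OF t] i_j)
  qed
  then have "coset (tensor3 sH) (D_left 1) = coset (tensor3 sH) (mult3 ?l ?r)"
    "coset (tensor3 sH) (D_left 1) = coset (tensor3 sH) (mult3 ?r ?l)"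
    by (intro coset_eqI subspace_tensor3; simp only: vanishes_iff)+
  then show "?one = ?lr" "?one = ?rl"
    by (simp_all only: map_left_\<Delta> unit_legs mult3_coset)
qed

lemma weak_bialgebra: "weak_bialgebra sH \<Delta> \<epsilon>"
  unfolding weak_bialgebra_def Let_def
  by (intro conjI allI H.k_algebra_axioms coalgebra \<Delta>_mult \<epsilon>_mult \<Delta>_unit)

end

theorem theorem5p5:
  fixes sR :: "'k::field \<Rightarrow> 'r::{ring, monoid_mult} \<Rightarrow> 'r"
    and sH :: "'k \<Rightarrow> 'h::{ring, monoid_mult} \<Rightarrow> 'h"
    and \<phi> :: "'r \<Rightarrow> 'k"
    and e :: "('r \<times> 'r \<Rightarrow>\<^sub>0 'k) set"
    and \<iota> :: "('r \<times> 'r \<Rightarrow>\<^sub>0 'k) set \<Rightarrow> 'h"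
    and \<Gamma> :: "'h \<Rightarrow> ('h \<times> 'h \<Rightarrow>\<^sub>0 'k) set"
    and C :: "'h \<Rightarrow> 'r \<Rightarrow> 'r"
  assumes "k_algebra sR"
    and "idempotent_frobenius_system sR \<phi> e"
    and "timesR_bialgebra sR sH \<iota> \<Gamma> C"
  shows "weak_bialgebra sH
    (\<lambda>h. qmap2 (tensor2 sH)
       (free_map2 (\<lambda>(r, s) (a, b). (inRbar sR \<iota> r * a, inR sR \<iota> s * b))) e (\<Gamma> h))
    (\<lambda>h. \<phi> (C h 1))"
proof -
  interpret frobenius_timesR_bialgebra sR sH \<phi> e \<iota> \<Gamma> C
    using assms(2,3) by (rule frobenius_timesR_bialgebra.intro)
  show ?thesis by (rule weak_bialgebra)
qed

end
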